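(* Let $X$ be a centered, nondegenerate, infinitely divisible real random variable with finite variance $V>0$ and Lévy measure $\nu$ on $\mathbb{R}\setminus\{0\}$. Then $$c_+(X)=0\iff\nu((0,\infty))=0,\qquad c_-(X)=0\iff\nu((-\infty,0))=0.$$ Consequently, $c_+(X)=c_-(X)=0$ if and only if $X$ is Gaussian with variance $V$.
   Context: With $a\ge0$ the Gaussian variance of $X$, $$K_X(t)=\log\mathbb{E}e^{tX}=\frac{at^2}{2}+\int_{\mathbb{R}\setminus\{0\}}(e^{tx}-1-tx)\,\nu(\mathrm{d}x)\in[0,\infty],\qquad V=a+\int x^2\,\nu(\mathrm{d}x).$$ Define $c_+(X)$ as the infimum of all $c\ge0$ such that $K_X(t)\le\frac{Vt^2}{2(1-ct)}$ for every $0\le t<1/c$ (with $1/0=\infty$ and $\inf\emptyset=\infty$), and $c_-(X)=c_+(-X)$. *)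

theory Defs
  imports "HOL-Probability.Probability"
begin

text \<open>A law on the reals is infinitely divisible if for every \<open>n \<ge> 1\<close> it is the law of a sum of
  \<open>n\<close> independent identically distributed real random variables.\<close>

definition infinitely_divisible :: "real measure \<Rightarrow> bool" where
  "infinitely_divisible \<mu> \<longleftrightarrow> real_distribution \<mu> \<and>
     (\<forall>n\<ge>1. \<exists>\<rho>. real_distribution \<rho> \<and>
        distr (Pi\<^sub>M {..<n::nat} (\<lambda>_. \<rho>)) borel (\<lambda>x. \<Sum>i<n. x i) = \<mu>)"

text \<open>A Levy measure on \<open>\<real> - {0}\<close> is represented as a Borel measure on \<open>\<real>\<close> with no mass at 0.\<close>

definition levy_measure :: "real measure \<Rightarrow> bool" where
  "levy_measure \<nu> \<longleftrightarrow> sets \<nu> = sets borel \<and> emeasure \<nu> {0} = 0 \<and>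
     (\<integral>\<^sup>+ x. ennreal (min 1 (x\<^sup>2)) \<partial>\<nu>) < \<infinity>"

text \<open>Levy-Khintchine representation of the characteristic function with drift \<open>b\<close>, Gaussian
  variance \<open>a\<close> and Levy measure \<open>\<nu>\<close>, for the truncation function \<open>x \<mapsto> x\<close> on \<open>[-1, 1]\<close>, 0 elsewhere.
  The triplet is uniquely determined by the law; the truncation affects \<open>b\<close> only. No second
  moment of \<open>\<nu>\<close> is presupposed.\<close>

definition levy_triplet :: "real measure \<Rightarrow> real \<Rightarrow> real \<Rightarrow> real measure \<Rightarrow> bool" where
  "levy_triplet \<mu> b a \<nu> \<longleftrightarrow> 0 \<le> a \<and> levy_measure \<nu> \<and>
     (\<forall>u::real. char \<mu> u =
        exp (\<i> * complex_of_real (b * u) - complex_of_real (a * u\<^sup>2 / 2)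
             + (CLINT x|\<nu>. iexp (u * x) - 1
                  - \<i> * complex_of_real (u * x * indicator {-1..1} x))))"

text \<open>The cumulant generating function \<open>log E exp (t X)\<close>, with value \<open>\<infinity>\<close> when the expectation
  diverges (the Bochner integral alone would return 0 there).\<close>

definition cumulant :: "'a measure \<Rightarrow> ('a \<Rightarrow> real) \<Rightarrow> real \<Rightarrow> ereal" where
  "cumulant M X t =
     (if integrable M (\<lambda>\<omega>. exp (t * X \<omega>)) then ereal (ln (\<integral>\<omega>. exp (t * X \<omega>) \<partial>M)) else \<infinity>)"

text \<open>In \<open>ereal\<close>, \<open>1 / 0 = \<infinity>\<close> and \<open>Inf {} = \<infinity>\<close>.\<close>

definition c_plus :: "'a measure \<Rightarrow> ('a \<Rightarrow> real) \<Rightarrow> ereal" where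
  "c_plus M X = Inf {ereal c | c::real. 0 \<le> c \<and>
     (\<forall>t::real. 0 \<le> t \<longrightarrow> ereal t < 1 / ereal c \<longrightarrow>
        cumulant M X t \<le> ereal (prob_space.variance M X * t\<^sup>2 / (2 * (1 - c * t))))}"

definition c_minus :: "'a measure \<Rightarrow> ('a \<Rightarrow> real) \<Rightarrow> ereal" where
  "c_minus M X = c_plus M (\<lambda>\<omega>. - X \<omega>)"

end

theory Submission
  imports Defs
begin

text \<open>Let \<open>\<rho> n\<close> be the \<open>n\<close>-th convolution root of the law of \<open>X\<close>. Letting \<open>c\<close> tend to 0, the condition
  \<open>c_plus M X = 0\<close> says that \<open>E exp (t X) \<le> exp (V t\<^sup>2 / 2)\<close> for all \<open>t \<ge> 0\<close>. Since \<open>\<rho> n\<close> is centered with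
  variance \<open>V / n\<close> and \<open>E exp (t X)\<close> is the \<open>n\<close>-th power of the exponential moment of \<open>\<rho> n\<close>, this
  holds if and only if \<open>n * measure (\<rho> n) {\<epsilon><..}\<close> tends to 0 for every \<open>\<epsilon> > 0\<close>. On the other hand the
  characteristic function of \<open>\<rho> n\<close> is \<open>exp (\<psi> / n)\<close> with \<open>\<psi>\<close> the Levy-Khintchine exponent, so
  \<open>n * (char (\<rho> n) u - 1)\<close> tends to \<open>\<psi> u\<close>. A fourth difference in \<open>u\<close> removes the drift and the Gaussian
  part, and Levy's continuity theorem shows that \<open>n (1 - cos (s x))\<^sup>2 \<rho> n(dx)\<close> converges weakly to
  \<open>(1 - cos (s x))\<^sup>2 \<nu>(dx)\<close>; hence these tails vanish in the limit if and only if \<open>\<nu>\<close> does not charge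
  the positive half-line.\<close>

subsection \<open>Convolution roots\<close>

definition convolution_root :: "nat \<Rightarrow> real measure \<Rightarrow> real measure \<Rightarrow> bool" where
  "convolution_root n \<mu> \<rho> \<longleftrightarrow> real_distribution \<rho> \<and>
     distr (Pi\<^sub>M {..<n} (\<lambda>_. \<rho>)) borel (\<lambda>x. \<Sum>i<n. x i) = \<mu>"

text \<open>Independence amounts to the joint law being the product of the marginals. Here the joint
  map is the identity on extensional functions, so its law is the product measure itself.\<close>

lemma indep_vars_coordinates:
  fixes N :: "'i \<Rightarrow> real measure"
  assumes N: "\<And>i. real_distribution (N i)" and "finite I" "I \<noteq> {}"
  shows "prob_space.indep_vars (Pi\<^sub>M I N) (\<lambda>_. borel) (\<lambda>i x. x i) I"
proof -
  have N': "prob_space (N i)" "sets (N i) = sets borel" for i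
    using N[of i] by (auto simp: real_distribution_def real_distribution_axioms_def)
  interpret P: prob_space "Pi\<^sub>M I N"
    by (rule prob_space_PiM) (rule N')
  have sets_eq: "sets (Pi\<^sub>M I N) = sets (Pi\<^sub>M I (\<lambda>_. borel))"
    by (rule sets_PiM_cong) (simp_all add: N')
  have meas: "(\<lambda>x. x i) \<in> borel_measurable (Pi\<^sub>M I N)" if "i \<in> I" for i
    using measurable_component_singleton[OF that, of N] by (simp add: measurable_cong_sets[OF refl N'(2)])
  have "distr (Pi\<^sub>M I N) borel (\<lambda>x. x i) = N i" if "i \<in> I" for i
    using distr_PiM_component[of I N i, OF N'(1)] assms that
    by (simp cong: distr_cong add: distr_cong[OF refl N'(2)])
  then have "(\<Pi>\<^sub>M i\<in>I. distr (Pi\<^sub>M I N) borel (\<lambda>x. x i)) = Pi\<^sub>M I N"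
    by (intro PiM_cong) auto
  moreover have "distr (Pi\<^sub>M I N) (\<Pi>\<^sub>M i\<in>I. borel) (\<lambda>x. \<lambda>i\<in>I. x i) = Pi\<^sub>M I N"
  proof -
    have "distr (Pi\<^sub>M I N) (\<Pi>\<^sub>M i\<in>I. borel) (\<lambda>x. \<lambda>i\<in>I. x i) = distr (Pi\<^sub>M I N) (Pi\<^sub>M I N) (\<lambda>x. x)"
      by (intro distr_cong) (auto simp: sets_eq space_PiM PiE_def extensional_restrict)
    then show ?thesis by simp
  qed
  ultimately show ?thesis
    by (subst P.indep_vars_iff_distr_eq_PiM') (use assms meas in auto)
qed

text \<open>The \<open>n\<close>-fold product of the root serves as a concrete sample space, so that
  statements about \<mu> become statements about sums of its iid coordinates.\<close>

lemma convolution_root_iid: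
  assumes "convolution_root n \<mu> \<rho>" "n \<ge> 1"
  defines "P \<equiv> Pi\<^sub>M {..<n} (\<lambda>_. \<rho>)"
  shows "prob_space P" "prob_space.indep_vars P (\<lambda>_. borel) (\<lambda>i x. x i) {..<n}"
    "\<And>i. i < n \<Longrightarrow> distr P borel (\<lambda>x. x i) = \<rho>"
    "\<And>i. i < n \<Longrightarrow> (\<lambda>x. x i) \<in> borel_measurable P"
proof -
  have \<rho>: "real_distribution \<rho>" using assms by (simp add: convolution_root_def)
  then have \<rho>': "prob_space \<rho>" "sets \<rho> = sets borel"
    by (auto simp: real_distribution_def real_distribution_axioms_def)
  show "prob_space P" unfolding P_def by (rule prob_space_PiM) (rule \<rho>')
  show "prob_space.indep_vars P (\<lambda>_. borel) (\<lambda>i x. x i) {..<n}"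
    unfolding P_def using assms(2) \<rho> by (intro indep_vars_coordinates) (auto simp: lessThan_empty_iff)
  show "distr P borel (\<lambda>x. x i) = \<rho>" if "i < n" for i
    using distr_PiM_component[of "{..<n}" "\<lambda>_. \<rho>" i] that \<rho>' unfolding P_def
    by (simp add: distr_cong[OF refl \<rho>'(2)])
  show "(\<lambda>x. x i) \<in> borel_measurable P" if "i < n" for i
    using measurable_component_singleton[of i "{..<n}" "\<lambda>_. \<rho>"] that
    by (simp add: P_def measurable_cong_sets[OF refl \<rho>'(2)])
qed

lemma convolution_root_char:
  assumes "convolution_root n \<mu> \<rho>" "n \<ge> 1"
  shows "char \<mu> u = char \<rho> u ^ n"
proof -
  define P where "P = Pi\<^sub>M {..<n} (\<lambda>_. \<rho>)"
  note iid = convolution_root_iid[OF assms, folded P_def]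
  interpret P: prob_space P by (rule iid)
  have "char \<mu> u = char (distr P borel (\<lambda>x. \<Sum>i<n. x i)) u"
    using assms by (simp add: convolution_root_def P_def)
  also have "\<dots> = (\<Prod>i<n. char (distr P borel (\<lambda>x. x i)) u)"
    using iid(2) by (rule P.char_distr_sum)
  also have "\<dots> = char \<rho> u ^ n" by (simp add: iid(3))
  finally show ?thesis .
qed

lemma convolution_root_nn_integral_sum:
  assumes "convolution_root n \<mu> \<rho>" "n \<ge> 1" and [measurable]: "f \<in> borel_measurable borel"
  shows "(\<integral>\<^sup>+x. f x \<partial>\<mu>) = (\<integral>\<^sup>+x. f (\<Sum>i<n. x i) \<partial>Pi\<^sub>M {..<n} (\<lambda>_. \<rho>))"
proof -
  note [measurable] = convolution_root_iid(4)[OF assms(1,2)]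
  have "(\<integral>\<^sup>+x. f x \<partial>\<mu>) = (\<integral>\<^sup>+x. f x \<partial>distr (Pi\<^sub>M {..<n} (\<lambda>_. \<rho>)) borel (\<lambda>x. \<Sum>i<n. x i))"
    using assms by (simp add: convolution_root_def)
  also have "\<dots> = (\<integral>\<^sup>+x. f (\<Sum>i<n. x i) \<partial>Pi\<^sub>M {..<n} (\<lambda>_. \<rho>))"
    by (intro nn_integral_distr) (auto intro!: borel_measurable_sum)
  finally show ?thesis .
qed

lemma convolution_root_nn_integral_coordinate:
  assumes "convolution_root n \<mu> \<rho>" "n \<ge> 1" "i < n" and [measurable]: "f \<in> borel_measurable borel"
  shows "(\<integral>\<^sup>+x. f (x i) \<partial>Pi\<^sub>M {..<n} (\<lambda>_. \<rho>)) = (\<integral>\<^sup>+x. f x \<partial>\<rho>)"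
proof -
  note [measurable] = convolution_root_iid(4)[OF assms(1,2,3)]
  have "(\<integral>\<^sup>+x. f x \<partial>\<rho>) = (\<integral>\<^sup>+x. f x \<partial>distr (Pi\<^sub>M {..<n} (\<lambda>_. \<rho>)) borel (\<lambda>x. x i))"
    using assms convolution_root_iid(3)[OF assms(1,2)] by simp
  also have "\<dots> = (\<integral>\<^sup>+x. f (x i) \<partial>Pi\<^sub>M {..<n} (\<lambda>_. \<rho>))"
    by (intro nn_integral_distr) auto
  finally show ?thesis ..
qed

lemma convolution_root_nn_integral_prod:
  fixes f :: "real \<Rightarrow> ennreal"
  assumes "convolution_root n \<mu> \<rho>" "n \<ge> 1" and [measurable]: "f \<in> borel_measurable borel"
  shows "(\<integral>\<^sup>+x. (\<Prod>i<n. f (x i)) \<partial>Pi\<^sub>M {..<n} (\<lambda>_. \<rho>)) = (\<integral>\<^sup>+x. f x \<partial>\<rho>) ^ n"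
proof -
  define P where "P = Pi\<^sub>M {..<n} (\<lambda>_. \<rho>)"
  note iid = convolution_root_iid[OF assms(1,2), folded P_def]
  interpret P: prob_space P by (rule iid)
  have "P.indep_vars (\<lambda>_. borel) (\<lambda>i x. f (x i)) {..<n}"
    by (rule P.indep_vars_compose2[OF iid(2)]) simp
  then have "(\<integral>\<^sup>+x. (\<Prod>i<n. f (x i)) \<partial>P) = (\<Prod>i<n. \<integral>\<^sup>+x. f (x i) \<partial>P)"
    by (intro P.indep_vars_nn_integral) auto
  also have "\<dots> = (\<integral>\<^sup>+x. f x \<partial>\<rho>) ^ n"
    unfolding P_def using assms by (simp add: convolution_root_nn_integral_coordinate)
  finally show ?thesis unfolding P_def .
qed

text \<open>The extended nonnegative integral lets the factorization cover infinite exponential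
  moments as well; finiteness for the root is later deduced from finiteness for \<mu>.\<close>

lemma convolution_root_nn_integral_exp:
  assumes "convolution_root n \<mu> \<rho>" "n \<ge> 1"
  shows "(\<integral>\<^sup>+x. ennreal (exp (t * x)) \<partial>\<mu>) = (\<integral>\<^sup>+x. ennreal (exp (t * x)) \<partial>\<rho>) ^ n"
proof -
  have "(\<integral>\<^sup>+x. ennreal (exp (t * x)) \<partial>\<mu>)
      = (\<integral>\<^sup>+x. ennreal (exp (t * (\<Sum>i<n. x i))) \<partial>Pi\<^sub>M {..<n} (\<lambda>_. \<rho>))"
    by (rule convolution_root_nn_integral_sum[OF assms]) simp
  also have "\<dots> = (\<integral>\<^sup>+x. (\<Prod>i<n. ennreal (exp (t * x i))) \<partial>Pi\<^sub>M {..<n} (\<lambda>_. \<rho>))"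
    by (simp add: prod_ennreal sum_distrib_left exp_sum)
  also have "\<dots> = (\<integral>\<^sup>+x. ennreal (exp (t * x)) \<partial>\<rho>) ^ n"
    by (rule convolution_root_nn_integral_prod[OF assms]) simp
  finally show ?thesis .
qed

section \<open>Moments of the roots\<close>

text \<open>By Fubini, \<open>(x + y)^2\<close> is integrable in \<open>x\<close> against the law of
  \<open>A\<close> for almost every value \<open>y\<close> of \<open>B\<close>. A single such
  \<open>y\<close> suffices, since a constant shift does not affect square-integrability.\<close>

lemma (in prob_space) indep_var_square_integrable_summand:
  fixes A B :: "'a \<Rightarrow> real"
  assumes indep: "indep_var borel A borel B"
    and int: "integrable M (\<lambda>\<omega>. (A \<omega> + B \<omega>)\<^sup>2)"
  shows "integrable M (\<lambda>\<omega>. (A \<omega>)\<^sup>2)"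
proof -
  have [measurable]: "A \<in> borel_measurable M" "B \<in> borel_measurable M"
    using indep by (auto simp: indep_var_distribution_eq)
  define \<alpha> where "\<alpha> = distr M borel A"
  define \<beta> where "\<beta> = distr M borel B"
  have [measurable_cong]: "sets \<alpha> = sets borel" "sets \<beta> = sets borel"
    by (auto simp: \<alpha>_def \<beta>_def)
  interpret \<alpha>: prob_space \<alpha> unfolding \<alpha>_def by (rule prob_space_distr) simp
  interpret \<beta>: prob_space \<beta> unfolding \<beta>_def by (rule prob_space_distr) simp
  interpret \<beta>\<alpha>: pair_sigma_finite \<alpha> \<beta> ..
  have "\<alpha> \<Otimes>\<^sub>M \<beta> = distr M (borel \<Otimes>\<^sub>M borel) (\<lambda>x. (A x, B x))"
    using indep by (simp add: indep_var_distribution_eq \<alpha>_def \<beta>_def)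
  moreover have "integrable (distr M (borel \<Otimes>\<^sub>M borel) (\<lambda>x. (A x, B x))) (\<lambda>(x,y). (x + y)\<^sup>2)"
    using int by (subst integrable_distr_eq) auto
  ultimately have "integrable (\<alpha> \<Otimes>\<^sub>M \<beta>) (\<lambda>(x,y). (x + y)\<^sup>2)" by simp
  then have "AE y in \<beta>. integrable \<alpha> (\<lambda>x. (x + y)\<^sup>2)"
    by (rule \<beta>\<alpha>.AE_integrable_snd)
  then obtain y where y: "integrable \<alpha> (\<lambda>x. (x + y)\<^sup>2)"
    using \<beta>.ae_filter_bot eventually_happens' by blast
  have "integrable \<alpha> (\<lambda>x. x\<^sup>2)"
  proof (rule Bochner_Integration.integrable_bound)
    show "integrable \<alpha> (\<lambda>x. 2 * (x + y)\<^sup>2 + 2 * y\<^sup>2)"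
      using y by auto
    \<comment> \<open>The right side minus the left side is \<open>(x + 2 * y)^2\<close>.\<close>
    have "x\<^sup>2 \<le> 2 * (x + y)\<^sup>2 + 2 * y\<^sup>2" for x
      using zero_le_power2[of "x + 2 * y"] by (simp add: power2_eq_square algebra_simps)
    then show "AE x in \<alpha>. norm (x\<^sup>2) \<le> norm (2 * (x + y)\<^sup>2 + 2 * y\<^sup>2)" by simp
  qed simp
  then show ?thesis unfolding \<alpha>_def by (subst (asm) integrable_distr_eq) auto
qed

text \<open>Splitting off coordinate 0 gives square-integrability of one summand. The mean then
  follows by linearity, and the second moments add up because independent centered coordinates are
  orthogonal.\<close>

lemma convolution_root_moments:
  assumes root: "convolution_root n \<mu> \<rho>" "n \<ge> 1"
    and int: "integrable \<mu> (\<lambda>x. x\<^sup>2)" and mean: "(\<integral>x. x \<partial>\<mu>) = 0"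
  shows "integrable \<rho> (\<lambda>x. x\<^sup>2)" "integrable \<rho> (\<lambda>x. x)" "(\<integral>x. x \<partial>\<rho>) = 0"
    "n * (\<integral>x. x\<^sup>2 \<partial>\<rho>) = (\<integral>x. x\<^sup>2 \<partial>\<mu>)"
proof -
  define P where "P = Pi\<^sub>M {..<n} (\<lambda>_. \<rho>)"
  note iid = convolution_root_iid[OF root, folded P_def]
  interpret P: prob_space P by (rule iid)
  note [measurable] = iid(4)
  interpret \<rho>: real_distribution \<rho> using root by (simp add: convolution_root_def)
  have sum_meas [measurable]: "(\<lambda>x. \<Sum>i<n. x i) \<in> borel_measurable P"
    by (intro borel_measurable_sum) auto
  have \<mu>: "\<mu> = distr P borel (\<lambda>x. \<Sum>i<n. x i)"
    using root by (simp add: convolution_root_def P_def)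
  have int_sum: "integrable P (\<lambda>x. (\<Sum>i<n. x i)\<^sup>2)"
    using int unfolding \<mu> by (subst (asm) integrable_distr_eq) auto
  have to_\<rho>: "integrable P (\<lambda>x. f (x i)) \<longleftrightarrow> integrable \<rho> f"
      "(\<integral>x. f (x i) \<partial>P) = (\<integral>x. f x \<partial>\<rho>)"
    if "i < n" "f \<in> borel_measurable borel" for f :: "real \<Rightarrow> real" and i
    using that by (auto simp flip: iid(3)[OF that(1)] simp: integrable_distr_eq integral_distr)
  have "{..<n} = insert 0 {1..<n}" using root(2) by auto
  then have split: "(\<Sum>i<n. x i) = x 0 + (\<Sum>i=1..<n. x i)" for x :: "nat \<Rightarrow> real"
    by simp
  have "P.indep_var borel (\<lambda>x. x 0) borel (\<lambda>x. \<Sum>i=1..<n. x i)"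
    using iid(2) \<open>{..<n} = _\<close> by (intro P.indep_vars_sum) auto
  then have "integrable P (\<lambda>x. (x 0)\<^sup>2)"
    using int_sum unfolding split by (rule P.indep_var_square_integrable_summand)
  then show sq: "integrable \<rho> (\<lambda>x. x\<^sup>2)"
    using root(2) by (subst (asm) to_\<rho>) auto
  then show id: "integrable \<rho> (\<lambda>x. x)"
    by (rule \<rho>.square_integrable_imp_integrable[rotated]) simp
  have id_meas: "(\<lambda>x::real. x) \<in> borel_measurable borel" by simp
  have int_i: "integrable P (\<lambda>x. x i)" if "i < n" for i
    using to_\<rho>(1)[OF that id_meas] id by blast
  have mean_i: "(\<integral>x. x i \<partial>P) = (\<integral>x. x \<partial>\<rho>)" if "i < n" for i
    using to_\<rho>(2)[OF that id_meas] by blast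
  have "0 = (\<integral>x. (\<Sum>i<n. x i) \<partial>P)"
    using mean unfolding \<mu> by (simp add: integral_distr)
  also have "\<dots> = (\<Sum>i<n. \<integral>x. x i \<partial>P)"
    by (intro Bochner_Integration.integral_sum) (auto intro: int_i)
  also have "\<dots> = n * (\<integral>x. x \<partial>\<rho>)"
    by (simp add: mean_i)
  finally show mean0: "(\<integral>x. x \<partial>\<rho>) = 0" using root(2) by auto
  have sq_meas: "(\<lambda>x::real. x\<^sup>2) \<in> borel_measurable borel" by simp
  have prod_int: "integrable P (\<lambda>x. x i * x j)" if "i < n" "j < n" for i j
  proof (rule Bochner_Integration.integrable_bound)
    show "integrable P (\<lambda>x. (x i)\<^sup>2 + (x j)\<^sup>2)"
      using to_\<rho>(1)[OF that(1) sq_meas] to_\<rho>(1)[OF that(2) sq_meas] sq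
      by (intro Bochner_Integration.integrable_add) blast+
    have "\<bar>u * v\<bar> \<le> u\<^sup>2 + v\<^sup>2" for u v :: real
    proof -
      have "2 * (\<bar>u\<bar> * \<bar>v\<bar>) \<le> u\<^sup>2 + v\<^sup>2" "0 \<le> \<bar>u\<bar> * \<bar>v\<bar>"
        using sum_squares_bound[of "\<bar>u\<bar>" "\<bar>v\<bar>"] by auto
      then show ?thesis unfolding abs_mult by linarith
    qed
    then show "AE x in P. norm (x i * x j) \<le> norm ((x i)\<^sup>2 + (x j)\<^sup>2)"
      by (simp add: abs_of_nonneg[OF sum_power2_ge_zero])
    show "(\<lambda>x. x i * x j) \<in> borel_measurable P"
      using that by (intro borel_measurable_times) auto
  qed
  have cross: "(\<integral>x. x i * x j \<partial>P) = (if i = j then \<integral>x. x\<^sup>2 \<partial>\<rho> else 0)" if "i < n" "j < n" for i j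
  proof (cases "i = j")
    case True
    then show ?thesis using to_\<rho>(2)[OF that(1) sq_meas] by (simp add: power2_eq_square)
  next
    case False
    \<comment> \<open>Writing the second variable as a sum over the singleton \<open>{j}\<close>
      lets \<open>indep_vars_sum\<close> deliver pairwise independence.\<close>
    have "P.indep_var borel (\<lambda>x. x i) borel (\<lambda>x. \<Sum>k\<in>{j}. x k)"
      using False that by (intro P.indep_vars_sum P.indep_vars_subset[OF iid(2)]) auto
    then have "(\<integral>x. x i * x j \<partial>P) = (\<integral>x. x i \<partial>P) * (\<integral>x. x j \<partial>P)"
      using that by (intro P.indep_var_lebesgue_integral int_i) auto
    also have "\<dots> = 0" using that by (simp add: mean_i mean0)
    finally show ?thesis using False by simp
  qed
  have "(\<integral>x. x\<^sup>2 \<partial>\<mu>) = (\<integral>x. (\<Sum>i<n. x i)\<^sup>2 \<partial>P)"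
    unfolding \<mu> by (simp add: integral_distr)
  also have "\<dots> = (\<integral>x. (\<Sum>i<n. \<Sum>j<n. x i * x j) \<partial>P)"
    by (simp add: power2_eq_square sum_product)
  also have "\<dots> = (\<Sum>i<n. \<Sum>j<n. \<integral>x. x i * x j \<partial>P)"
    by (subst Bochner_Integration.integral_sum, intro Bochner_Integration.integrable_sum prod_int)
       (auto intro!: sum.cong Bochner_Integration.integral_sum prod_int)
  also have "\<dots> = (\<Sum>i<n. \<Sum>j<n. if i = j then \<integral>x. x\<^sup>2 \<partial>\<rho> else 0)"
    by (intro sum.cong refl cross) auto
  also have "\<dots> = n * (\<integral>x. x\<^sup>2 \<partial>\<rho>)" by simp
  finally show "n * (\<integral>x. x\<^sup>2 \<partial>\<rho>) = (\<integral>x. x\<^sup>2 \<partial>\<mu>)" ..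
qed

text \<open>Negating each coordinate keeps the family independent, so the product of reflected roots
  is the image of the original product under coordinatewise negation, and the sum merely changes
  sign.\<close>

lemma infinitely_divisible_reflect:
  assumes "infinitely_divisible \<mu>"
  shows "infinitely_divisible (distr \<mu> borel uminus)"
  unfolding infinitely_divisible_def
proof (intro conjI allI impI)
  interpret \<mu>: real_distribution \<mu> using assms by (simp add: infinitely_divisible_def)
  show "real_distribution (distr \<mu> borel uminus)" by (intro \<mu>.real_distribution_distr) simp
  fix n :: nat assume n: "1 \<le> n"
  then obtain \<rho> where root: "convolution_root n \<mu> \<rho>"
    using assms unfolding infinitely_divisible_def convolution_root_def by blast
  then interpret \<rho>: real_distribution \<rho> by (simp add: convolution_root_def)
  define P where "P = Pi\<^sub>M {..<n} (\<lambda>_. \<rho>)"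
  note iid = convolution_root_iid[OF root n, folded P_def]
  interpret P: prob_space P by (rule iid)
  note [measurable] = iid(4)
  have \<mu>: "\<mu> = distr P borel (\<lambda>x. \<Sum>i<n. x i)"
    using root by (simp add: convolution_root_def P_def)
  define \<rho>' where "\<rho>' = distr \<rho> borel uminus"
  have \<rho>'_eq: "distr P borel (\<lambda>x. - x i) = \<rho>'" if "i < n" for i
    unfolding \<rho>'_def using that by (simp flip: iid(3)[OF that] add: distr_distr comp_def)
  have "P.indep_vars (\<lambda>_. borel) (\<lambda>i x. - x i) {..<n}"
    by (rule P.indep_vars_compose2[OF iid(2)]) simp
  then have "distr P (\<Pi>\<^sub>M i\<in>{..<n}. borel) (\<lambda>x. \<lambda>i\<in>{..<n}. - x i)
      = (\<Pi>\<^sub>M i\<in>{..<n}. distr P borel (\<lambda>x. - x i))"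
    using n by (subst (asm) P.indep_vars_iff_distr_eq_PiM') (auto simp: lessThan_empty_iff)
  also have "\<dots> = (\<Pi>\<^sub>M i\<in>{..<n}. \<rho>')"
    by (intro PiM_cong) (auto simp: \<rho>'_eq)
  finally have PiM: "(\<Pi>\<^sub>M i\<in>{..<n}. \<rho>') = distr P (\<Pi>\<^sub>M i\<in>{..<n}. borel) (\<lambda>x. \<lambda>i\<in>{..<n}. - x i)" ..
  have "distr (\<Pi>\<^sub>M i\<in>{..<n}. \<rho>') borel (\<lambda>x. \<Sum>i<n. x i) = distr P borel (\<lambda>x. \<Sum>i<n. - x i)"
    unfolding PiM by (subst distr_distr) (auto simp: comp_def intro!: borel_measurable_sum)
  also have "\<dots> = distr \<mu> borel uminus"
    unfolding \<mu> by (subst distr_distr) (auto simp: comp_def sum_negf)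
  finally show "\<exists>\<rho>. real_distribution \<rho> \<and>
      distr (Pi\<^sub>M {..<n} (\<lambda>_. \<rho>)) borel (\<lambda>x. \<Sum>i<n. x i) = distr \<mu> borel uminus"
    by (intro exI[of _ \<rho>'] conjI) (auto simp: \<rho>'_def intro!: \<rho>.real_distribution_distr)
qed
subsection \<open>Exponential moments and tails of the roots\<close>

text \<open>The second-order Lagrange remainder is \<open>y^2 / 2 * exp t\<close> with
  \<open>t\<close> between 0 and \<open>y\<close>, and \<open>t <= c\<close> for either sign of
  \<open>y\<close> because \<open>c\<close> is nonnegative.\<close>

lemma exp_le_quadratic:
  fixes y c :: real
  assumes "y \<le> c" "0 \<le> c"
  shows "exp y \<le> 1 + y + y\<^sup>2 / 2 * exp c"
proof (cases "y = 0")
  case False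
  have "\<forall>m t. m < 2 \<and> min y 0 \<le> t \<and> t \<le> max y 0 \<longrightarrow> ((exp :: real \<Rightarrow> real) has_real_derivative exp t) (at t)"
    by (auto intro: DERIV_exp)
  then obtain t where "if y < 0 then y < t \<and> t < 0 else 0 < t \<and> t < y"
    and "exp y = (\<Sum>m<2. exp 0 / fact m * (y - 0) ^ m) + exp t / fact 2 * (y - 0) ^ 2"
    using Taylor[of 2 "\<lambda>_. exp" exp "min y 0" "max y 0" 0 y] False by auto
  then have t: "if y < 0 then y < t \<and> t < 0 else 0 < t \<and> t < y"
    and eq: "exp y = 1 + y + exp t / 2 * y\<^sup>2"
    by (auto simp: numeral_2_eq_2 lessThan_Suc)
  from t have "exp t \<le> exp c" using assms by (auto split: if_splits)
  then show ?thesis unfolding eq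
    using mult_right_mono[of "exp t" "exp c" "y\<^sup>2 / 2"] by (simp add: mult.commute)
qed auto

text \<open>Drops the quadratic and all higher terms of the series. The order three is what matters:
  it will outgrow the quadratic exponent \<open>V * t^2 / 2\<close> for large
  \<open>t\<close>.\<close>

lemma exp_ge_cubic:
  fixes y :: real
  assumes "0 \<le> y"
  shows "1 + y + y ^ 3 / 6 \<le> exp y"
proof -
  have "(\<Sum>k<4. inverse (fact k) *\<^sub>R y ^ k) \<le> exp y"
    unfolding exp_def
    by (rule sum_le_suminf) (use summable_exp_generic[of y] assms in auto)
  moreover have "(\<Sum>k<4. inverse (fact k) *\<^sub>R y ^ k) = 1 + y + y\<^sup>2 / 2 + y ^ 3 / 6"
    by (simp add: eval_nat_numeral lessThan_Suc fact_numeral field_simps)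
  ultimately show ?thesis using zero_le_power2[of y] by linarith
qed

lemma ennreal_power_le_imp_le:
  fixes x :: ennreal
  assumes "x ^ n \<le> ennreal b ^ n" "0 \<le> b" "n \<ge> 1"
  shows "x \<le> ennreal b"
proof (cases x)
  case (real r)
  then show ?thesis using assms by (simp add: ennreal_power power_mono_iff ennreal_leI)
next
  case top
  then show ?thesis using assms by (simp add: ennreal_power top_unique)
qed

text \<open>Truncation caps the exponent at \<open>t * \<epsilon>\<close>, which makes the quadratic
  bound available. In its linear term \<open>min x \<epsilon>\<close> is enlarged to
  \<open>x\<close>, so that centering removes it. The final bound is an exponential so that
  \<open>n\<close>-th powers can be taken without loss.\<close>

lemma nn_integral_exp_truncated_le:
  assumes "real_distribution \<rho>" "integrable \<rho> (\<lambda>x. x\<^sup>2)" "integrable \<rho> (\<lambda>x. x)" "(\<integral>x. x \<partial>\<rho>) = 0"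
    and "0 \<le> t" "0 \<le> \<epsilon>"
  shows "(\<integral>\<^sup>+x. ennreal (exp (t * min x \<epsilon>)) \<partial>\<rho>) \<le> ennreal (exp (t\<^sup>2 * exp (t * \<epsilon>) / 2 * (\<integral>x. x\<^sup>2 \<partial>\<rho>)))"
proof -
  interpret real_distribution \<rho> by fact
  define K where "K = t\<^sup>2 * exp (t * \<epsilon>) / 2"
  have bound: "exp (t * min x \<epsilon>) \<le> 1 + t * x + K * x\<^sup>2" for x
  proof -
    have "(min x \<epsilon>)\<^sup>2 \<le> x\<^sup>2" using \<open>0 \<le> \<epsilon>\<close> by (auto simp: min_def abs_le_square_iff[symmetric])
    then have "K * (min x \<epsilon>)\<^sup>2 \<le> K * x\<^sup>2" by (intro mult_left_mono) (auto simp: K_def)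
    moreover have "t * min x \<epsilon> \<le> t * x" using \<open>0 \<le> t\<close> by (intro mult_left_mono) auto
    moreover have "exp (t * min x \<epsilon>) \<le> 1 + t * min x \<epsilon> + (t * min x \<epsilon>)\<^sup>2 / 2 * exp (t * \<epsilon>)"
      using assms by (intro exp_le_quadratic mult_left_mono) auto
    moreover have "(t * min x \<epsilon>)\<^sup>2 / 2 * exp (t * \<epsilon>) = K * (min x \<epsilon>)\<^sup>2"
      by (simp add: K_def power_mult_distrib)
    ultimately show ?thesis by linarith
  qed
  have "(\<integral>\<^sup>+x. ennreal (exp (t * min x \<epsilon>)) \<partial>\<rho>) \<le> (\<integral>\<^sup>+x. ennreal (1 + t * x + K * x\<^sup>2) \<partial>\<rho>)"
    by (intro nn_integral_mono ennreal_leI bound)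
  also have "\<dots> = ennreal (\<integral>x. 1 + t * x + K * x\<^sup>2 \<partial>\<rho>)"
    using assms by (intro nn_integral_eq_integral AE_I2 order_trans[OF _ bound]) auto
  also have "(\<integral>x. 1 + t * x + K * x\<^sup>2 \<partial>\<rho>) = 1 + K * (\<integral>x. x\<^sup>2 \<partial>\<rho>)"
    using assms by (simp add: prob_space del: space_eq_univ)
  also have "\<dots> \<le> exp (K * (\<integral>x. x\<^sup>2 \<partial>\<rho>))" by (rule exp_ge_add_one_self)
  finally show ?thesis by (simp add: K_def ennreal_leI)
qed

text \<open>Chernoff bound: if no summand exceeds \<open>\<epsilon>\<close>, then truncating the summands at \<open>\<epsilon>\<close> does not
  change the sum; the remaining event is paid for by the crude bound \<open>exp (t * k)\<close>.\<close>

lemma convolution_root_truncated_exp_le: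
  assumes root: "convolution_root n \<mu> \<rho>" "n \<ge> 1"
    and int: "integrable \<mu> (\<lambda>x. x\<^sup>2)" and mean: "(\<integral>x. x \<partial>\<mu>) = 0"
    and "0 \<le> t" "0 \<le> \<epsilon>"
  shows "(\<integral>\<^sup>+x. ennreal (exp (t * min x k)) \<partial>\<mu>)
    \<le> ennreal (exp (t\<^sup>2 * exp (t * \<epsilon>) / 2 * (\<integral>x. x\<^sup>2 \<partial>\<mu>)) + exp (t * k) * (n * measure \<rho> {\<epsilon><..}))"
proof -
  interpret \<rho>: real_distribution \<rho> using root by (simp add: convolution_root_def)
  note moments = convolution_root_moments[OF root int mean]
  note [measurable] = convolution_root_iid(4)[OF root]
  define P where "P = Pi\<^sub>M {..<n} (\<lambda>_. \<rho>)"
  have pointwise: "ennreal (exp (t * min (\<Sum>i<n. x i) k))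
      \<le> (\<Prod>i<n. ennreal (exp (t * min (x i) \<epsilon>)))
        + (\<Sum>i<n. ennreal (exp (t * k)) * indicator {\<epsilon><..} (x i))" for x :: "nat \<Rightarrow> real"
  proof (cases "\<exists>i<n. \<epsilon> < x i")
    case True
    then obtain i where i: "i < n" "\<epsilon> < x i" by auto
    have "ennreal (exp (t * min (\<Sum>i<n. x i) k)) \<le> ennreal (exp (t * k))"
      using \<open>0 \<le> t\<close> by (intro ennreal_leI) (simp add: mult_left_mono)
    also have "\<dots> = ennreal (exp (t * k)) * indicator {\<epsilon><..} (x i)" using i by simp
    also have "\<dots> \<le> (\<Sum>i<n. ennreal (exp (t * k)) * indicator {\<epsilon><..} (x i))"
      using i by (intro member_le_sum) auto
    finally show ?thesis by (rule add_increasing[rotated]) simp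
  next
    case False
    then have "(\<Sum>i<n. x i) = (\<Sum>i<n. min (x i) \<epsilon>)"
      by (intro sum.cong refl) (metis lessThan_iff min_absorb1 not_less)
    then have "exp (t * min (\<Sum>i<n. x i) k) \<le> exp (t * (\<Sum>i<n. min (x i) \<epsilon>))"
      using \<open>0 \<le> t\<close> by (simp add: mult_left_mono)
    also have "\<dots> = (\<Prod>i<n. exp (t * min (x i) \<epsilon>))"
      by (simp add: exp_sum sum_distrib_left)
    finally have "ennreal (exp (t * min (\<Sum>i<n. x i) k)) \<le> (\<Prod>i<n. ennreal (exp (t * min (x i) \<epsilon>)))"
      by (simp add: prod_ennreal ennreal_leI)
    then show ?thesis by (rule add_increasing2[rotated]) simp
  qed
  have "(\<integral>\<^sup>+x. ennreal (exp (t * min x k)) \<partial>\<mu>) = (\<integral>\<^sup>+x. ennreal (exp (t * min (\<Sum>i<n. x i) k)) \<partial>P)"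
    unfolding P_def by (rule convolution_root_nn_integral_sum[OF root]) simp
  also have "\<dots> \<le> (\<integral>\<^sup>+x. (\<Prod>i<n. ennreal (exp (t * min (x i) \<epsilon>)))
        + (\<Sum>i<n. ennreal (exp (t * k)) * indicator {\<epsilon><..} (x i)) \<partial>P)"
    by (intro nn_integral_mono pointwise)
  also have "\<dots> = (\<integral>\<^sup>+x. (\<Prod>i<n. ennreal (exp (t * min (x i) \<epsilon>))) \<partial>P)
        + (\<Sum>i<n. \<integral>\<^sup>+x. ennreal (exp (t * k)) * indicator {\<epsilon><..} (x i) \<partial>P)"
    unfolding P_def
    by (subst nn_integral_add; (subst nn_integral_sum)?)
       (auto intro!: borel_measurable_prod_ennreal borel_measurable_sum measurable_compose[OF convolution_root_iid(4)[OF root]])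
  also have "(\<integral>\<^sup>+x. (\<Prod>i<n. ennreal (exp (t * min (x i) \<epsilon>))) \<partial>P)
      = (\<integral>\<^sup>+x. ennreal (exp (t * min x \<epsilon>)) \<partial>\<rho>) ^ n"
    unfolding P_def by (rule convolution_root_nn_integral_prod[OF root]) simp
  also have "\<dots> \<le> ennreal (exp (t\<^sup>2 * exp (t * \<epsilon>) / 2 * (\<integral>x. x\<^sup>2 \<partial>\<rho>))) ^ n"
    using moments assms by (intro power_mono nn_integral_exp_truncated_le \<rho>.real_distribution_axioms) auto
  \<comment> \<open>Since \<open>n\<close> times the second moment of \<rho> is that of \<mu>, the
    \<open>n\<close>-th power no longer depends on \<open>n\<close>.\<close>
  also have "\<dots> = ennreal (exp (t\<^sup>2 * exp (t * \<epsilon>) / 2 * (\<integral>x. x\<^sup>2 \<partial>\<mu>)))"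
    unfolding moments(4)[symmetric] by (simp add: ennreal_power mult.left_commute flip: exp_of_nat_mult)
  also have "(\<Sum>i<n. \<integral>\<^sup>+x. ennreal (exp (t * k)) * indicator {\<epsilon><..} (x i) \<partial>P)
      = (\<Sum>i<n. \<integral>\<^sup>+x. ennreal (exp (t * k)) * indicator {\<epsilon><..} x \<partial>\<rho>)"
    unfolding P_def by (intro sum.cong refl convolution_root_nn_integral_coordinate[OF root]) auto
  also have "\<dots> = ennreal (exp (t * k) * (n * measure \<rho> {\<epsilon><..}))"
    by (simp add: nn_integral_cmult_indicator \<rho>.emeasure_eq_measure ennreal_of_nat_eq_real_of_nat ennreal_mult' mult.left_commute)
  finally show ?thesis by (simp add: add_right_mono ennreal_plus)
qed

text \<open>One root has exponential moment at most \<open>exp (v / n) <= 1 + 2 * v / n\<close>,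
  where \<open>v <= n\<close> permits the quadratic bound on \<open>exp\<close>. The cubic lower
  bound, whose linear term integrates to 0, gives at least \<open>1 + (t * \<epsilon>)^3 / 6\<close>
  times the tail added to 1; hence the factor 12.\<close>

lemma subgaussian_imp_tail_le:
  assumes root: "convolution_root n \<mu> \<rho>" "n \<ge> 1"
    and int: "integrable \<mu> (\<lambda>x. x\<^sup>2)" and mean: "(\<integral>x. x \<partial>\<mu>) = 0"
    and sub: "(\<integral>\<^sup>+x. ennreal (exp (t * x)) \<partial>\<mu>) \<le> ennreal (exp v)"
    and "0 < t" "0 < \<epsilon>" "0 \<le> v" "v \<le> n"
  shows "n * measure \<rho> {\<epsilon><..} \<le> 12 * v / (t * \<epsilon>) ^ 3"
proof -
  interpret \<rho>: real_distribution \<rho> using root by (simp add: convolution_root_def)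
  note moments = convolution_root_moments[OF root int mean]
  define I where "I = (\<integral>\<^sup>+x. ennreal (exp (t * x)) \<partial>\<rho>)"
  have "I ^ n \<le> ennreal (exp (v / n)) ^ n"
    using sub root(2) unfolding I_def convolution_root_nn_integral_exp[OF root]
    by (simp add: ennreal_power flip: exp_of_nat_mult)
  then have I_le: "I \<le> ennreal (exp (v / n))"
    using root(2) by (intro ennreal_power_le_imp_le) (auto simp: I_def)
  then have int_exp: "integrable \<rho> (\<lambda>x. exp (t * x))"
    by (intro integrableI_nonneg) (auto simp: I_def less_top[symmetric] top_unique)
  then have exp_le: "(\<integral>x. exp (t * x) \<partial>\<rho>) \<le> exp (v / n)"
    using I_le unfolding I_def by (subst (asm) nn_integral_eq_integral) auto
  \<comment> \<open>The cubic term is kept only on the tail, where \<open>x\<close> exceeds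
    \<epsilon>; elsewhere the tangent line at 0 bounds the exponential from below.\<close>
  have "1 + (t * \<epsilon>) ^ 3 / 6 * measure \<rho> {\<epsilon><..} = (\<integral>x. 1 + t * x + (t * \<epsilon>) ^ 3 / 6 * indicator {\<epsilon><..} x \<partial>\<rho>)"
    using moments(2,3) by (simp add: \<rho>.prob_space \<rho>.emeasure_eq_measure del: \<rho>.space_eq_univ)
  also have "\<dots> \<le> (\<integral>x. exp (t * x) \<partial>\<rho>)"
  proof (intro integral_mono int_exp)
    show "integrable \<rho> (\<lambda>x. 1 + t * x + (t * \<epsilon>) ^ 3 / 6 * indicator {\<epsilon><..} x)"
      using moments(2)
      by (intro Bochner_Integration.integrable_add integrable_mult_right integrable_real_indicator)
         (auto simp: \<rho>.emeasure_eq_measure)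
    fix x show "1 + t * x + (t * \<epsilon>) ^ 3 / 6 * indicator {\<epsilon><..} x \<le> exp (t * x)"
    proof (cases "\<epsilon> < x")
      case True
      then have "(t * \<epsilon>) ^ 3 \<le> (t * x) ^ 3" using assms by (intro power_mono) auto
      moreover have "1 + t * x + (t * x) ^ 3 / 6 \<le> exp (t * x)"
        using True assms by (intro exp_ge_cubic) auto
      ultimately show ?thesis using True by simp
    qed (use exp_ge_add_one_self[of "t * x"] in simp)
  qed
  also have "\<dots> \<le> exp (v / n)" by (rule exp_le)
  also have "\<dots> \<le> 1 + v / n + (v / n)\<^sup>2" using assms by (intro exp_bound) auto
  also have "\<dots> \<le> 1 + 2 * (v / n)"
    using assms mult_left_le[of "v / n" "v / n"] by (simp add: power2_eq_square)
  finally have "(t * \<epsilon>) ^ 3 * measure \<rho> {\<epsilon><..} \<le> 12 * (v / n)" by simp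
  then have "(n * measure \<rho> {\<epsilon><..}) * (t * \<epsilon>) ^ 3 \<le> 12 * v"
    using root(2) by (simp add: field_simps)
  then show ?thesis using assms by (simp add: pos_le_divide_eq)
qed

text \<open>From left to right, \<open>v = V * t^2 / 2\<close> turns the tail bound into
  \<open>6 * V / (t * \<epsilon>^3)\<close>, which is small for large \<open>t\<close>. From right
  to left the order of limits matters: first \<open>n\<close> to infinity for fixed \<epsilon> and
  truncation level \<open>k\<close>, then \<epsilon> to 0, then \<open>k\<close> to infinity by
  monotone convergence.\<close>

lemma subgaussian_iff_tails_vanish:
  assumes root: "\<And>n. n \<ge> 1 \<Longrightarrow> convolution_root n \<mu> (\<rho> n)"
    and "real_distribution \<mu>"
    and int: "integrable \<mu> (\<lambda>x. x\<^sup>2)" and mean: "(\<integral>x. x \<partial>\<mu>) = 0" and V: "(\<integral>x. x\<^sup>2 \<partial>\<mu>) = V"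
  shows "(\<forall>t\<ge>0. (\<integral>\<^sup>+x. ennreal (exp (t * x)) \<partial>\<mu>) \<le> ennreal (exp (V * t\<^sup>2 / 2))) \<longleftrightarrow>
    (\<forall>\<epsilon>>0. (\<lambda>n. n * measure (\<rho> n) {\<epsilon><..}) \<longlonglongrightarrow> 0)"
    (is "?sub \<longleftrightarrow> ?tails")
proof
  interpret \<mu>: real_distribution \<mu> by fact
  have "0 \<le> V" unfolding V[symmetric] by simp
  assume sub: ?sub
  show ?tails
  proof (intro allI impI tendstoI)
    fix \<epsilon> \<eta> :: real assume pos: "0 < \<epsilon>" "0 < \<eta>"
    \<comment> \<open>Chosen so that \<open>6 * V / (t * \<epsilon>^3) < \<eta>\<close>; the summand
      1 makes the inequality strict and \<open>t\<close> positive.\<close>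
    define t where "t = 6 * V / (\<epsilon> ^ 3 * \<eta>) + 1"
    have t: "0 < t" "6 * V / (\<epsilon> ^ 3 * \<eta>) < t" using pos \<open>0 \<le> V\<close> by (auto simp: t_def add_nonneg_pos)
    define v where "v = V * t\<^sup>2 / 2"
    show "eventually (\<lambda>n. dist (n * measure (\<rho> n) {\<epsilon><..}) 0 < \<eta>) sequentially"
      using eventually_ge_at_top[of "max 1 (nat \<lceil>v\<rceil>)"]
    proof eventually_elim
      case (elim n)
      have "n * measure (\<rho> n) {\<epsilon><..} \<le> 12 * v / (t * \<epsilon>) ^ 3"
      proof (rule subgaussian_imp_tail_le[OF root _ int mean])
        show "(\<integral>\<^sup>+x. ennreal (exp (t * x)) \<partial>\<mu>) \<le> ennreal (exp v)"
          using sub t by (simp add: v_def)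
      qed (use elim t pos \<open>0 \<le> V\<close> in \<open>simp_all add: v_def nat_ceiling_le_eq\<close>)
      also have "\<dots> = 6 * V / (\<epsilon> ^ 3 * \<eta>) * (\<eta> / t)"
        using t pos by (simp add: v_def field_simps power2_eq_square power3_eq_cube)
      also have "\<dots> < t * (\<eta> / t)"
        using t pos by (intro mult_strict_right_mono) auto
      finally show ?case using t by simp
    qed
  qed
next
  interpret \<mu>: real_distribution \<mu> by fact
  assume tails: ?tails
  show ?sub
  proof (intro allI impI)
    fix t :: real assume t: "0 \<le> t"
    have bound_\<epsilon>: "(\<integral>\<^sup>+x. ennreal (exp (t * min x k)) \<partial>\<mu>) \<le> ennreal (exp (t\<^sup>2 * exp (t * \<epsilon>) / 2 * V))"
      if "0 < \<epsilon>" for \<epsilon> k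
    proof (rule tendsto_lowerbound)
      let ?f = "\<lambda>n. ennreal (exp (t\<^sup>2 * exp (t * \<epsilon>) / 2 * V) + exp (t * k) * (n * measure (\<rho> n) {\<epsilon><..}))"
      have "(\<lambda>n. exp (t\<^sup>2 * exp (t * \<epsilon>) / 2 * V) + exp (t * k) * (n * measure (\<rho> n) {\<epsilon><..}))
          \<longlonglongrightarrow> exp (t\<^sup>2 * exp (t * \<epsilon>) / 2 * V) + exp (t * k) * 0"
        using tails that by (intro tendsto_intros) auto
      then show "?f \<longlonglongrightarrow> ennreal (exp (t\<^sup>2 * exp (t * \<epsilon>) / 2 * V))"
        by (intro tendsto_ennrealI) simp
      show "eventually (\<lambda>n. (\<integral>\<^sup>+x. ennreal (exp (t * min x k)) \<partial>\<mu>) \<le> ?f n) sequentially"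
        using eventually_ge_at_top[of 1]
        by eventually_elim
           (use convolution_root_truncated_exp_le[OF root _ int mean t less_imp_le[OF that]] V in auto)
    qed simp
    have bound: "(\<integral>\<^sup>+x. ennreal (exp (t * min x k)) \<partial>\<mu>) \<le> ennreal (exp (V * t\<^sup>2 / 2))" for k
    proof (rule tendsto_lowerbound)
      have "((\<lambda>\<epsilon>. exp (t\<^sup>2 * exp (t * \<epsilon>) / 2 * V)) \<longlongrightarrow> exp (t\<^sup>2 * exp (t * 0) / 2 * V)) (at_right 0)"
        by (intro tendsto_intros) auto
      then show "((\<lambda>\<epsilon>. ennreal (exp (t\<^sup>2 * exp (t * \<epsilon>) / 2 * V))) \<longlongrightarrow> ennreal (exp (V * t\<^sup>2 / 2))) (at_right 0)"
        by (intro tendsto_ennrealI) (simp add: mult.commute)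
      show "eventually (\<lambda>\<epsilon>. (\<integral>\<^sup>+x. ennreal (exp (t * min x k)) \<partial>\<mu>)
          \<le> ennreal (exp (t\<^sup>2 * exp (t * \<epsilon>) / 2 * V))) (at_right 0)"
        using eventually_at_right_less[of "0::real"] by eventually_elim (rule bound_\<epsilon>)
    qed simp
    have "incseq (\<lambda>k x. ennreal (exp (t * min x (real k))))"
      using t by (auto simp: incseq_def le_fun_def intro!: ennreal_leI mult_left_mono)
    then have "(\<integral>\<^sup>+x. (SUP k. ennreal (exp (t * min x (real k)))) \<partial>\<mu>)
        = (SUP k. \<integral>\<^sup>+x. ennreal (exp (t * min x (real k))) \<partial>\<mu>)"
      by (intro nn_integral_monotone_convergence_SUP) auto
    note SUP_eq = this
    have "ennreal (exp (t * x)) \<le> (SUP k. ennreal (exp (t * min x (real k))))" for x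
      by (rule SUP_upper2[of "nat \<lceil>x\<rceil>"]) (auto simp: min_absorb1 real_nat_ceiling_ge)
    then have "(\<integral>\<^sup>+x. ennreal (exp (t * x)) \<partial>\<mu>) \<le> (SUP k. \<integral>\<^sup>+x. ennreal (exp (t * min x (real k))) \<partial>\<mu>)"
      unfolding SUP_eq[symmetric] by (rule nn_integral_mono)
    also have "\<dots> \<le> ennreal (exp (V * t\<^sup>2 / 2))" by (intro SUP_least bound)
    finally show "(\<integral>\<^sup>+x. ennreal (exp (t * x)) \<partial>\<mu>) \<le> ennreal (exp (V * t\<^sup>2 / 2))" .
  qed
qed
subsection \<open>Characteristic exponents and weak limits\<close>

lemma real_distribution_normalize:
  assumes "finite_borel_measure M" and pos: "0 < measure M UNIV"
  defines "N \<equiv> density M (\<lambda>_. ennreal (1 / measure M UNIV))"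
  shows "real_distribution N" "char N t = char M t / measure M UNIV"
    "measure N {x<..} = measure M {x<..} / measure M UNIV"
proof -
  interpret finite_borel_measure M by fact
  have [measurable_cong, simp]: "sets M = sets borel" by (rule M_is_borel)
  have sp: "space M = UNIV" by (rule borel_UNIV)
  have em: "emeasure N A = ennreal (measure M A / measure M UNIV)" if "A \<in> sets borel" for A
    using that pos
    by (simp add: N_def emeasure_density_const emeasure_eq_measure mult.commute flip: ennreal_mult)
  show "real_distribution N"
  proof (intro real_distribution.intro prob_spaceI real_distribution_axioms.intro)
    show "emeasure N (space N) = 1"
      using em[of UNIV] pos sp by (simp add: N_def)
  qed (simp add: N_def)
  show "char N t = char M t / measure M UNIV"
    unfolding char_def N_def using pos
    by (subst integral_density) (auto simp: scaleR_conv_of_real)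
  show "measure N {x<..} = measure M {x<..} / measure M UNIV"
    unfolding measure_def[of N] by (simp add: em)
qed

text \<open>Weak convergence controls tails only at continuity points of the limit. If the limit
  does not charge the positive half-line, every positive point is one. Conversely, atoms are
  countable, so a continuity point exists below any \<epsilon>, and its tail dominates the tail at
  \<epsilon>.\<close>

lemma weak_conv_m_tails:
  assumes "\<And>n. real_distribution (N n)" "real_distribution N'" "weak_conv_m N N'"
  shows "(\<forall>\<epsilon>>0. measure N' {\<epsilon><..} = 0) \<longleftrightarrow> (\<forall>\<epsilon>>0. (\<lambda>n. measure (N n) {\<epsilon><..}) \<longlonglongrightarrow> 0)"
proof -
  have tail: "measure M {x<..} = 1 - cdf M x" if "real_distribution M" for M and x :: real
  proof -
    interpret real_distribution M by fact
    have "{x<..} = space M - {..x}" by auto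
    then show ?thesis by (simp only: cdf_def prob_compl sets_M borel_closed closed_atMost)
  qed
  interpret N': real_distribution N' by fact
  have conv: "(\<lambda>n. measure (N n) {x<..}) \<longlonglongrightarrow> measure N' {x<..}" if "isCont (cdf N') x" for x
    using assms(3) that unfolding weak_conv_m_def weak_conv_def
    by (simp add: tail assms(1,2) tendsto_diff)
  show ?thesis
  proof (intro iffI allI impI)
    fix \<epsilon> :: real assume *: "\<forall>\<epsilon>>0. measure N' {\<epsilon><..} = 0" "0 < \<epsilon>"
    have "measure N' {\<epsilon>} \<le> measure N' {\<epsilon>/2<..}"
      using * by (intro N'.finite_measure_mono) auto
    then have "isCont (cdf N') \<epsilon>"
      using * by (simp add: N'.isCont_cdf measure_le_0_iff)
    then show "(\<lambda>n. measure (N n) {\<epsilon><..}) \<longlonglongrightarrow> 0"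
      using conv[of \<epsilon>] * by simp
  next
    fix \<epsilon> :: real assume *: "\<forall>\<epsilon>>0. (\<lambda>n. measure (N n) {\<epsilon><..}) \<longlonglongrightarrow> 0" "0 < \<epsilon>"
    have "\<not> {0<..<\<epsilon>} \<subseteq> {x. 0 < measure N' {x}}"
      using N'.countable_atoms uncountable_open_interval[of 0 \<epsilon>] * countable_subset by auto
    then obtain x where x: "0 < x" "x < \<epsilon>" "\<not> 0 < measure N' {x}"
      by (metis greaterThanLessThan_iff mem_Collect_eq subsetI)
    then have "isCont (cdf N') x" by (simp add: N'.isCont_cdf zero_less_measure_iff)
    then have "measure N' {x<..} = 0"
      using conv[of x] * x LIMSEQ_unique by blast
    moreover have "measure N' {\<epsilon><..} \<le> measure N' {x<..}"
      using x by (intro N'.finite_measure_mono) auto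
    ultimately show "measure N' {\<epsilon><..} = 0" by (simp add: measure_le_0_iff)
  qed
qed

text \<open>Reduces to Levy's continuity theorem by normalization. If the limit has mass 0 there is
  nothing to normalize, but then the masses tend to 0.\<close>

lemma char_convergence_tails:
  assumes fin: "\<And>n. finite_borel_measure (M n)" "finite_borel_measure M'"
    and conv: "\<And>t. (\<lambda>n. char (M n) t) \<longlonglongrightarrow> char M' t"
  shows "(\<forall>\<epsilon>>0. measure M' {\<epsilon><..} = 0) \<longleftrightarrow> (\<forall>\<epsilon>>0. (\<lambda>n. measure (M n) {\<epsilon><..}) \<longlonglongrightarrow> 0)"
proof -
  have char_0: "char M 0 = of_real (measure M UNIV)" if "finite_borel_measure M" for M
    using finite_borel_measure.borel_UNIV[OF that] by (simp add: char_def scaleR_conv_of_real)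
  \<comment> \<open>The value of a characteristic function at 0 is the total mass.\<close>
  have mass: "(\<lambda>n. measure (M n) UNIV) \<longlonglongrightarrow> measure M' UNIV"
    using tendsto_Re[OF conv[of 0]] by (simp add: char_0 fin)
  have mono: "measure M A \<le> measure M UNIV" if "finite_borel_measure M" for M and A :: "real set"
    using finite_measure.bounded_measure[OF finite_borel_measure.axioms(1)[OF that]]
      finite_borel_measure.borel_UNIV[OF that] by metis
  show ?thesis
  proof (cases "measure M' UNIV = 0")
    case True
    have "(\<lambda>n. measure (M n) {\<epsilon><..}) \<longlonglongrightarrow> 0" for \<epsilon>
      by (rule tendsto_sandwich[OF _ _ tendsto_const]) (use mass mono[OF fin(1)] True in auto)
    moreover have "measure M' {\<epsilon><..} = 0" for \<epsilon>
      using mono[OF fin(2), of "{\<epsilon><..}"] True by (simp add: measure_le_0_iff)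
    ultimately show ?thesis by simp
  next
    case False
    then have pos': "0 < measure M' UNIV" by (simp add: zero_less_measure_iff)
    \<comment> \<open>The masses are only eventually positive, so the sequence is shifted by
      \<open>k\<close> before normalizing.\<close>
    obtain k where pos: "\<And>n. 0 < measure (M (n + k)) UNIV"
      using order_tendstoD(1)[OF mass pos'] unfolding eventually_sequentially
      by (metis add.commute le_add1)
    define N where "N n = density (M (n + k)) (\<lambda>_. ennreal (1 / measure (M (n + k)) UNIV))" for n
    define N' where "N' = density M' (\<lambda>_. ennreal (1 / measure M' UNIV))"
    note N = real_distribution_normalize[OF fin(1) pos, folded N_def]
    note N' = real_distribution_normalize[OF fin(2) pos', folded N'_def]
    have mass_k: "(\<lambda>n. measure (M (n + k)) UNIV) \<longlonglongrightarrow> measure M' UNIV"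
      by (rule LIMSEQ_ignore_initial_segment[OF mass])
    have "weak_conv_m N N'"
    proof (rule levy_continuity[OF N(1) N'(1)])
      show "(\<lambda>n. char (N n) t) \<longlonglongrightarrow> char N' t" for t
        unfolding N(2) N'(2) using pos'
        by (intro tendsto_intros mass_k LIMSEQ_ignore_initial_segment[OF conv]) auto
    qed
    then have "(\<forall>\<epsilon>>0. measure N' {\<epsilon><..} = 0) \<longleftrightarrow> (\<forall>\<epsilon>>0. (\<lambda>n. measure (N n) {\<epsilon><..}) \<longlonglongrightarrow> 0)"
      by (rule weak_conv_m_tails[OF N(1) N'(1)])
    moreover have "(\<lambda>n. measure (N n) {\<epsilon><..}) \<longlonglongrightarrow> 0 \<longleftrightarrow> (\<lambda>n. measure (M n) {\<epsilon><..}) \<longlonglongrightarrow> 0" for \<epsilon>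
    proof
      assume "(\<lambda>n. measure (N n) {\<epsilon><..}) \<longlonglongrightarrow> 0"
      then have "(\<lambda>n. measure (N n) {\<epsilon><..} * measure (M (n + k)) UNIV) \<longlonglongrightarrow> 0"
        by (rule tendsto_eq_rhs[OF tendsto_mult[OF _ mass_k]]) simp
      moreover have "measure (N n) {\<epsilon><..} * measure (M (n + k)) UNIV = measure (M (n + k)) {\<epsilon><..}" for n
        using pos[of n] by (simp add: N(3))
      ultimately show "(\<lambda>n. measure (M n) {\<epsilon><..}) \<longlonglongrightarrow> 0"
        by (simp add: LIMSEQ_offset[of _ k])
    next
      assume "(\<lambda>n. measure (M n) {\<epsilon><..}) \<longlonglongrightarrow> 0"
      then show "(\<lambda>n. measure (N n) {\<epsilon><..}) \<longlonglongrightarrow> 0"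
        unfolding N(3) using pos'
        by (intro tendsto_eq_rhs[OF tendsto_divide[OF LIMSEQ_ignore_initial_segment mass_k]]) auto
    qed
    moreover have "measure N' {\<epsilon><..} = 0 \<longleftrightarrow> measure M' {\<epsilon><..} = 0" for \<epsilon>
      using pos' by (simp add: N'(3))
    ultimately show ?thesis by simp
  qed
qed

section \<open>The Levy-Khintchine exponent\<close>

definition levy_integrand :: "real \<Rightarrow> real \<Rightarrow> complex" where
  "levy_integrand u x = iexp (u * x) - 1 - \<i> * complex_of_real (u * x * indicator {-1..1} x)"

definition levy_exponent :: "real \<Rightarrow> real \<Rightarrow> real measure \<Rightarrow> real \<Rightarrow> complex" where
  "levy_exponent b a \<nu> u = \<i> * complex_of_real (b * u) - complex_of_real (a * u\<^sup>2 / 2)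
     + (CLINT x|\<nu>. levy_integrand u x)"

lemma levy_triplet_char:
  "levy_triplet \<mu> b a \<nu> \<Longrightarrow> char \<mu> u = exp (levy_exponent b a \<nu> u)"
  by (simp add: levy_triplet_def levy_exponent_def levy_integrand_def)

lemma levy_integrand_measurable [measurable]: "levy_integrand u \<in> borel_measurable borel"
  unfolding levy_integrand_def[abs_def] by measurable

text \<open>On \<open>[-1, 1]\<close> the compensator leaves the second-order Taylor remainder, at
  most \<open>(u * x)^2 / 2\<close>; outside it vanishes and the rest has modulus at most 2. The sum
  \<open>u^2 + 2\<close> covers both cases and is bounded for bounded \<open>u\<close>, as dominated
  convergence requires.\<close>

lemma norm_levy_integrand_le: "cmod (levy_integrand u x) \<le> (u\<^sup>2 + 2) * min 1 (x\<^sup>2)"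
proof (cases "\<bar>x\<bar> \<le> 1")
  case True
  then have "x\<^sup>2 \<le> 1" by (simp add: abs_square_le_1)
  have "cmod (levy_integrand u x) \<le> (u * x)\<^sup>2 / 2"
    using iexp_approx1[of "u * x" 1] True
    by (simp add: levy_integrand_def indicator_def abs_le_iff diff_diff_eq numeral_2_eq_2 power2_eq_square)
  also have "\<dots> \<le> (u\<^sup>2 + 2) * x\<^sup>2"
    by (simp add: power_mult_distrib algebra_simps)
  finally show ?thesis using \<open>x\<^sup>2 \<le> 1\<close> by simp
next
  case False
  then have "1 \<le> x\<^sup>2" using one_le_power[of "\<bar>x\<bar>" 2] by simp
  moreover have "cmod (iexp (u * x) - 1) \<le> 2"
    using norm_triangle_ineq4[of "iexp (u * x)" 1] by simp
  moreover have "levy_integrand u x = iexp (u * x) - 1"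
    using False by (auto simp: levy_integrand_def indicator_def)
  ultimately show ?thesis by (simp add: add_increasing)
qed

context
  fixes \<nu> :: "real measure"
  assumes \<nu>: "levy_measure \<nu>"
begin

lemma levy_measure_sets: "sets \<nu> = sets borel"
  using \<nu> by (simp add: levy_measure_def)

lemma integrable_min_1_square: "integrable \<nu> (\<lambda>x. min 1 (x\<^sup>2))"
proof (rule integrableI_nonneg)
  note [measurable_cong] = levy_measure_sets
  show "(\<lambda>x. min 1 (x\<^sup>2)) \<in> borel_measurable \<nu>" by simp
qed (use \<nu> in \<open>simp_all add: levy_measure_def\<close>)

lemma integrable_levy_integrand: "integrable \<nu> (levy_integrand u)"
proof (rule Bochner_Integration.integrable_bound)
  note [measurable_cong] = levy_measure_sets
  show "integrable \<nu> (\<lambda>x. (u\<^sup>2 + 2) * min 1 (x\<^sup>2))"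
    by (intro integrable_mult_right integrable_min_1_square)
  show "levy_integrand u \<in> borel_measurable \<nu>" by simp
qed (auto intro!: AE_I2 order_trans[OF norm_levy_integrand_le])

lemma continuous_levy_exponent: "continuous_on UNIV (levy_exponent b a \<nu>)"
proof -
  have "isCont (\<lambda>u. CLINT x|\<nu>. levy_integrand u x) u" for u
    unfolding continuous_at_sequentially comp_def
  proof safe
    note [measurable_cong] = levy_measure_sets
    fix v :: "nat \<Rightarrow> real" assume v: "v \<longlonglongrightarrow> u"
    \<comment> \<open>A convergent sequence of frequencies is bounded, which yields one dominating
      function for all \<open>n\<close>.\<close>
    then obtain B where B: "\<And>n. \<bar>v n\<bar> \<le> B"
      using convergent_imp_Bseq[of v] by (auto simp: convergent_def Bseq_def)
    show "(\<lambda>n. CLINT x|\<nu>. levy_integrand (v n) x) \<longlonglongrightarrow> (CLINT x|\<nu>. levy_integrand u x)"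
    proof (rule integral_dominated_convergence[where w="\<lambda>x. (B\<^sup>2 + 2) * min 1 (x\<^sup>2)"])
      show "AE x in \<nu>. (\<lambda>n. levy_integrand (v n) x) \<longlonglongrightarrow> levy_integrand u x"
        unfolding levy_integrand_def by (intro AE_I2 tendsto_intros v)
      show "AE x in \<nu>. cmod (levy_integrand (v n) x) \<le> (B\<^sup>2 + 2) * min 1 (x\<^sup>2)" for n
      proof (intro AE_I2 order_trans[OF norm_levy_integrand_le] mult_right_mono add_right_mono)
        show "(v n)\<^sup>2 \<le> B\<^sup>2" using power_mono[OF B, of n 2] by simp
      qed simp
    qed (auto intro: integrable_min_1_square)
  qed
  then show ?thesis
    unfolding levy_exponent_def[abs_def]
    by (intro continuous_intros continuous_at_imp_continuous_on ballI) auto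
qed

end

text \<open>The quotient of \<open>\<phi>\<close> and \<open>exp (\<psi> / n)\<close> is a continuous function with values in the \<open>n\<close>-th
  roots of unity.\<close>

lemma continuous_nth_root_eq_exp:
  fixes \<phi> \<psi> :: "real \<Rightarrow> complex"
  assumes "continuous_on UNIV \<phi>" "continuous_on UNIV \<psi>" "n \<ge> 1"
    and pow: "\<And>u. \<phi> u ^ n = exp (\<psi> u)" and "\<phi> 0 = 1" "\<psi> 0 = 0"
  shows "\<phi> u = exp (\<psi> u / n)"
proof -
  define q where "q u = \<phi> u / exp (\<psi> u / n)" for u
  have "q u ^ n = 1" for u
    using assms(3) by (simp add: q_def power_divide pow flip: exp_of_nat_mult)
  then have "q ` UNIV \<subseteq> {z. z ^ n = 1}" by auto
  moreover have "finite {z :: complex. z ^ n = 1}"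
    using finite_nth_roots[of n "1 :: complex"] assms(3) by simp
  ultimately have "finite (q ` UNIV)" by (rule finite_subset)
  moreover have "continuous_on UNIV q"
    unfolding q_def[abs_def] using assms(3) by (intro continuous_intros assms) auto
  \<comment> \<open>Connectedness of the real line fixes the branch of the \<open>n\<close>-th root,
    which is determined at 0.\<close>
  ultimately have "q constant_on UNIV"
    by (intro continuous_finite_range_constant) auto
  then have "q u = q 0" by (auto simp: constant_on_def)
  then show ?thesis using assms by (simp add: q_def)
qed

text \<open>This is the derivative of \<open>exp (z * h)\<close> at 0 along
  \<open>h = 1 / n\<close>; it recovers the exponent from the characteristic functions of the
  roots.\<close>

lemma of_nat_mult_exp_minus_1_tendsto:
  fixes z :: complex
  shows "(\<lambda>n. of_nat n * (exp (z / of_nat n) - 1)) \<longlonglongrightarrow> z"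
proof -
  have "((\<lambda>h. exp (z * h)) has_field_derivative z) (at 0)"
    by (auto intro!: derivative_eq_intros)
  then have "((\<lambda>h. (exp (z * h) - 1) / h) \<longlongrightarrow> z) (at 0)"
    by (simp add: has_field_derivative_iff)
  moreover have "filterlim (\<lambda>n. 1 / of_nat n :: complex) (at 0) sequentially"
    using lim_1_over_n[where 'a=complex] eventually_gt_at_top[of 0]
    by (auto simp: filterlim_at elim!: eventually_mono)
  ultimately have "(\<lambda>n. (exp (z * (1 / of_nat n)) - 1) / (1 / of_nat n)) \<longlonglongrightarrow> z"
    by (rule filterlim_compose)
  then show ?thesis by (simp add: mult.commute)
qed

text \<open>One quarter of a symmetric fourth difference; it annihilates the drift and the Gaussian part of
  the exponent.\<close>

definition fourth_diff :: "real \<Rightarrow> (real \<Rightarrow> complex) \<Rightarrow> real \<Rightarrow> complex" where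
  "fourth_diff s f u = 3 / 2 * f u - (f (u + s) + f (u - s)) + 1 / 4 * (f (u + 2 * s) + f (u - 2 * s))"

text \<open>Symmetric shifts multiply the exponential by cosines, and with
  \<open>c = cos (s * x)\<close> the weights give
  \<open>3/2 - 2 * c + (2 * c^2 - 1) / 2 = (1 - c)^2\<close>.\<close>

lemma fourth_diff_iexp:
  "fourth_diff s (\<lambda>u. iexp (u * x)) u = (1 - cos (s * x))\<^sup>2 *\<^sub>R iexp (u * x)"
proof -
  have sum: "iexp ((u + r) * x) + iexp ((u - r) * x) = 2 * cos (r * x) *\<^sub>R iexp (u * x)" for r
    by (simp add: complex_eq_iff scaleR_conv_of_real Re_exp Im_exp distrib_right left_diff_distrib cos_add cos_diff sin_add sin_diff)
  have cos_double: "cos (2 * s * x) = 2 * (cos (s * x))\<^sup>2 - 1"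
    using cos_double_cos[of "s * x"] by (simp add: mult.assoc)
  then show ?thesis
    unfolding fourth_diff_def sum cos_double by (simp add: scaleR_conv_of_real power2_eq_square algebra_simps)
qed

lemma fourth_diff_integral:
  assumes "\<And>v. integrable M (f v)"
  shows "integrable M (\<lambda>x. fourth_diff s (\<lambda>v. f v x) u)"
    "fourth_diff s (\<lambda>v. CLINT x|M. f v x) u = (CLINT x|M. fourth_diff s (\<lambda>v. f v x) u)"
  unfolding fourth_diff_def using assms by simp_all

lemma fourth_diff_char:
  assumes "real_distribution \<rho>"
  shows "fourth_diff s (char \<rho>) u = (CLINT x|\<rho>. (1 - cos (s * x))\<^sup>2 *\<^sub>R iexp (u * x))"
proof -
  interpret real_distribution \<rho> by fact
  have "integrable \<rho> (\<lambda>x. iexp (v * x))" for v by (rule integrable_iexp) simp_all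
  from fourth_diff_integral(2)[of \<rho> "\<lambda>v x. iexp (v * x)", OF this] show ?thesis
    by (simp only: fourth_diff_iexp char_def[abs_def])
qed

lemma fourth_diff_levy_integrand:
  "fourth_diff s (\<lambda>u. levy_integrand u x) u = (1 - cos (s * x))\<^sup>2 *\<^sub>R iexp (u * x)"
  unfolding fourth_diff_iexp[symmetric] by (simp add: fourth_diff_def levy_integrand_def algebra_simps)

text \<open>Drift and Gaussian part are polynomials of degree at most two in \<open>u\<close>, which
  the difference annihilates. Integrability is inherited from the integrands at the five nodes, so
  the weight has a finite integral even if \<nu> is infinite.\<close>

lemma fourth_diff_levy_exponent:
  assumes "levy_measure \<nu>"
  shows "integrable \<nu> (\<lambda>x. (1 - cos (s * x))\<^sup>2 *\<^sub>R iexp (u * x))"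
    "fourth_diff s (levy_exponent b a \<nu>) u = (CLINT x|\<nu>. (1 - cos (s * x))\<^sup>2 *\<^sub>R iexp (u * x))"
proof -
  note fourth_diff = fourth_diff_integral[of \<nu> levy_integrand, OF integrable_levy_integrand[OF assms], of s u]
  show "integrable \<nu> (\<lambda>x. (1 - cos (s * x))\<^sup>2 *\<^sub>R iexp (u * x))"
    using fourth_diff(1) by (simp only: fourth_diff_levy_integrand)
  have "fourth_diff s (levy_exponent b a \<nu>) u = fourth_diff s (\<lambda>u. CLINT x|\<nu>. levy_integrand u x) u"
    by (simp add: fourth_diff_def levy_exponent_def power2_eq_square algebra_simps add_divide_distrib diff_divide_distrib)
  also have "\<dots> = (CLINT x|\<nu>. (1 - cos (s * x))\<^sup>2 *\<^sub>R iexp (u * x))"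
    using fourth_diff(2) by (simp only: fourth_diff_levy_integrand)
  finally show "fourth_diff s (levy_exponent b a \<nu>) u = (CLINT x|\<nu>. (1 - cos (s * x))\<^sup>2 *\<^sub>R iexp (u * x))" .
qed
subsection \<open>Tails of the roots and the Levy measure\<close>

lemma measure_density_eq_integral:
  fixes f :: "'a \<Rightarrow> real"
  assumes "integrable M f" "\<And>x. 0 \<le> f x" and [measurable]: "A \<in> sets M"
  shows "measure (density M f) A = (\<integral>x. f x * indicator A x \<partial>M)"
proof -
  have [measurable]: "f \<in> borel_measurable M" using assms(1) by simp
  have "emeasure (density M f) A = (\<integral>\<^sup>+x. ennreal (f x * indicator A x) \<partial>M)"
    by (auto simp: emeasure_density indicator_def intro!: nn_integral_cong)
  also have "\<dots> = ennreal (\<integral>x. f x * indicator A x \<partial>M)"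
    using assms by (intro nn_integral_eq_integral integrable_real_mult_indicator) auto
  finally show ?thesis
    using assms(2) by (simp add: measure_def)
qed

lemma finite_borel_measure_density:
  fixes f :: "real \<Rightarrow> real"
  assumes "sets M = sets borel" "integrable M f" "\<And>x. 0 \<le> f x"
  shows "finite_borel_measure (density M f)"
proof (intro finite_borel_measure.intro finite_measureI finite_borel_measure_axioms.intro)
  have "emeasure (density M f) (space (density M f)) = (\<integral>\<^sup>+x. ennreal (f x) \<partial>M)"
    using assms by (auto simp: emeasure_density intro!: nn_integral_cong)
  also have "\<dots> < \<infinity>" using assms by (simp add: nn_integral_eq_integral)
  finally show "emeasure (density M f) (space (density M f)) \<noteq> \<infinity>" by simp
qed (simp add: assms)

lemma char_density:
  fixes f :: "real \<Rightarrow> real"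
  assumes "sets M = sets borel" "f \<in> borel_measurable M" "\<And>x. 0 \<le> f x"
  shows "char (density M f) u = (CLINT x|M. f x *\<^sub>R iexp (u * x))"
proof -
  have "(\<lambda>x. iexp (u * x)) \<in> borel_measurable M"
    using assms(1) by (simp cong: measurable_cong_sets)
  then show ?thesis
    unfolding char_def using assms by (subst integral_density) auto
qed

text \<open>The measures with densities \<open>n * w\<close> and \<open>w\<close> with respect to
  \<open>\<rho> n\<close> and \<nu> are finite, and their characteristic functions are fourth
  differences of \<open>n * (char (\<rho> n) - 1)\<close> and \<psi>. Pointwise convergence of the
  former to \<psi> therefore suffices. A weighted \<nu>-tail is zero exactly when the weight
  vanishes almost everywhere on it.\<close>

lemma weighted_tails_iff:
  assumes \<rho>: "\<And>n. real_distribution (\<rho> n)"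
    and root: "\<And>n. n \<ge> 1 \<Longrightarrow> convolution_root n \<mu> (\<rho> n)"
    and triplet: "levy_triplet \<mu> b a \<nu>"
  shows "(\<forall>\<epsilon>>0. AE x in \<nu>. \<epsilon> < x \<longrightarrow> cos (s * x) = 1) \<longleftrightarrow>
    (\<forall>\<epsilon>>0. (\<lambda>n. n * (\<integral>x. (1 - cos (s * x))\<^sup>2 * indicator {\<epsilon><..} x \<partial>\<rho> n)) \<longlonglongrightarrow> 0)"
proof -
  have \<nu>: "levy_measure \<nu>" using triplet by (simp add: levy_triplet_def)
  have sets_\<nu> [measurable_cong, simp]: "sets \<nu> = sets borel" using \<nu> by (rule levy_measure_sets)
  have sets_\<rho> [measurable_cong, simp]: "sets (\<rho> n) = sets borel" for n
    using \<rho>[of n] by (simp add: real_distribution_def real_distribution_axioms_def)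
  define \<psi> where "\<psi> = levy_exponent b a \<nu>"
  define w where "w x = (1 - cos (s * x))\<^sup>2" for x
  have [measurable]: "w \<in> borel_measurable borel" unfolding w_def[abs_def] by measurable
  have w_le: "w x \<le> 4" for x
    using power_mono[of "1 - cos (s * x)" 2 2] by (simp add: w_def)
  have w_nonneg: "0 \<le> w x" for x by (simp add: w_def)
  have int_\<rho>: "integrable (\<rho> n) w" for n
  proof -
    interpret real_distribution "\<rho> n" by (rule \<rho>)
    show ?thesis by (rule integrable_const_bound[of _ 4]) (auto simp: w_le w_nonneg)
  qed
  have int_\<nu>: "integrable \<nu> w"
    using fourth_diff_levy_exponent(1)[OF \<nu>, of s 0, THEN integrable_Re] by (simp add: w_def[abs_def])
  have \<phi>: "char (\<rho> n) u = exp (\<psi> u / n)" if n: "n \<ge> 1" for n u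
  proof (rule continuous_nth_root_eq_exp[OF _ _ n])
    interpret real_distribution "\<rho> n" by (rule \<rho>)
    show "continuous_on UNIV (char (\<rho> n))"
      by (simp add: continuous_at_imp_continuous_on isCont_char)
    show "continuous_on UNIV \<psi>" unfolding \<psi>_def by (rule continuous_levy_exponent[OF \<nu>])
    show "char (\<rho> n) u ^ n = exp (\<psi> u)" for u
      using convolution_root_char[OF root[OF n] n] levy_triplet_char[OF triplet] by (simp add: \<psi>_def)
    show "char (\<rho> n) 0 = 1" by (rule char_zero)
    show "\<psi> 0 = 0" by (simp add: \<psi>_def levy_exponent_def levy_integrand_def)
  qed
  have conv: "(\<lambda>n. of_nat n * (char (\<rho> n) u - 1)) \<longlonglongrightarrow> \<psi> u" for u
    by (rule Lim_transform_eventually[OF of_nat_mult_exp_minus_1_tendsto])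
       (use eventually_ge_at_top[of 1] in eventually_elim, simp add: \<phi>)
  define M where "M n = density (\<rho> n) (\<lambda>x. n * w x)" for n :: nat
  define M' where "M' = density \<nu> w"
  have char_M: "char (M n) u = fourth_diff s (\<lambda>u. of_nat n * (char (\<rho> n) u - 1)) u" for n u
  proof -
    have "char (M n) u = (CLINT x|\<rho> n. (n * w x) *\<^sub>R iexp (u * x))"
      unfolding M_def using int_\<rho>[of n] by (intro char_density) (auto simp: w_nonneg)
    also have "\<dots> = (CLINT x|\<rho> n. n *\<^sub>R (w x *\<^sub>R iexp (u * x)))" by simp
    also have "\<dots> = n *\<^sub>R fourth_diff s (char (\<rho> n)) u"
      unfolding integral_scaleR_right fourth_diff_char[OF \<rho>] by (simp add: w_def)
    \<comment> \<open>The difference annihilates constants, so subtracting 1 changes nothing and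
      produces the quantity known to converge.\<close>
    also have "\<dots> = fourth_diff s (\<lambda>u. of_nat n * (char (\<rho> n) u - 1)) u"
      by (simp add: fourth_diff_def scaleR_conv_of_real algebra_simps)
    finally show ?thesis .
  qed
  have "char M' u = fourth_diff s \<psi> u" for u
    unfolding M'_def \<psi>_def fourth_diff_levy_exponent(2)[OF \<nu>]
    using int_\<nu> by (subst char_density) (auto simp: w_nonneg w_def)
  then have "(\<lambda>n. char (M n) u) \<longlonglongrightarrow> char M' u" for u
    unfolding char_M fourth_diff_def by (auto intro!: tendsto_intros conv)
  then have iff: "(\<forall>\<epsilon>>0. measure M' {\<epsilon><..} = 0) \<longleftrightarrow> (\<forall>\<epsilon>>0. (\<lambda>n. measure (M n) {\<epsilon><..}) \<longlonglongrightarrow> 0)"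
    unfolding M_def M'_def
    by (intro char_convergence_tails finite_borel_measure_density) (auto simp: w_nonneg int_\<rho> int_\<nu>)
  have "measure (M n) {\<epsilon><..} = n * (\<integral>x. w x * indicator {\<epsilon><..} x \<partial>\<rho> n)" for n \<epsilon>
    unfolding M_def
    by (subst measure_density_eq_integral) (auto simp: w_nonneg int_\<rho> mult.assoc)
  moreover have "measure M' {\<epsilon><..} = 0 \<longleftrightarrow> (AE x in \<nu>. \<epsilon> < x \<longrightarrow> cos (s * x) = 1)" for \<epsilon>
  proof -
    have "measure M' {\<epsilon><..} = (\<integral>x. w x * indicator {\<epsilon><..} x \<partial>\<nu>)"
      unfolding M'_def by (rule measure_density_eq_integral) (auto simp: w_nonneg int_\<nu>)
    also have "\<dots> = 0 \<longleftrightarrow> (AE x in \<nu>. w x * indicator {\<epsilon><..} x = 0)"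
      by (intro integral_nonneg_eq_0_iff_AE integrable_real_mult_indicator int_\<nu>) (auto simp: w_nonneg)
    also have "\<dots> \<longleftrightarrow> (AE x in \<nu>. \<epsilon> < x \<longrightarrow> cos (s * x) = 1)"
      by (intro AE_cong) (auto simp: w_def indicator_def)
    finally show ?thesis .
  qed
  ultimately show ?thesis using iff by (simp add: w_def)
qed

text \<open>The weight \<open>(1 - cos (s * x))\<^sup>2\<close> is bounded below on \<open>{\<epsilon><..L}\<close> for \<open>s = 1 / L\<close>; beyond \<open>L\<close>
  Chebyshev's inequality gives \<open>n * measure (\<rho> n) {L<..} \<le> V / L\<^sup>2\<close> uniformly in \<open>n\<close>.\<close>

lemma tails_vanish_iff_levy_measure:
  assumes \<rho>: "\<And>n. real_distribution (\<rho> n)"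
    and root: "\<And>n. n \<ge> 1 \<Longrightarrow> convolution_root n \<mu> (\<rho> n)"
    and triplet: "levy_triplet \<mu> b a \<nu>"
    and int: "integrable \<mu> (\<lambda>x. x\<^sup>2)" and mean: "(\<integral>x. x \<partial>\<mu>) = 0"
  shows "(\<forall>\<epsilon>>0. (\<lambda>n. n * measure (\<rho> n) {\<epsilon><..}) \<longlonglongrightarrow> 0) \<longleftrightarrow> emeasure \<nu> {0<..} = 0"
proof
  have sets_\<nu> [measurable_cong, simp]: "sets \<nu> = sets borel"
    using triplet by (simp add: levy_triplet_def levy_measure_def)
  have null_iff: "emeasure \<nu> {0<..} = 0 \<longleftrightarrow> (AE x in \<nu>. \<not> 0 < x)"
    by (subst AE_iff_measurable[OF _ refl]) (auto simp: sets_eq_imp_space_eq[OF sets_\<nu>] greaterThan_def)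
  define w where "w s x = (1 - cos (s * x))\<^sup>2" for s x :: real
  have w_meas [measurable]: "w s \<in> borel_measurable borel" for s unfolding w_def[abs_def] by measurable
  have w_le: "w s x \<le> 4" for s x
    using power_mono[of "1 - cos (s * x)" 2 2] by (simp add: w_def)
  have w_nonneg: "0 \<le> w s x" for s x by (simp add: w_def)
  have int_w: "integrable (\<rho> n) (\<lambda>x. w s x * indicator {\<epsilon><..} x)" for n s \<epsilon>
  proof -
    interpret real_distribution "\<rho> n" by (rule \<rho>)
    show ?thesis
      by (rule integrable_const_bound[of _ 4]) (auto simp: w_le w_nonneg indicator_def)
  qed
  note weighted = weighted_tails_iff[OF \<rho> root triplet, folded w_def]
  have int_ind: "integrable (\<rho> n) (indicator {\<epsilon><..} :: real \<Rightarrow> real)" for n \<epsilon>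
  proof -
    interpret real_distribution "\<rho> n" by (rule \<rho>)
    show ?thesis by (auto simp: emeasure_eq_measure)
  qed
  {
    assume tails: "\<forall>\<epsilon>>0. (\<lambda>n. n * measure (\<rho> n) {\<epsilon><..}) \<longlonglongrightarrow> 0"
    have "(\<lambda>n. n * (\<integral>x. w s x * indicator {\<epsilon><..} x \<partial>\<rho> n)) \<longlonglongrightarrow> 0" if "0 < \<epsilon>" for s \<epsilon>
    proof (rule tendsto_sandwich[OF _ _ tendsto_const])
      have "(\<integral>x. w s x * indicator {\<epsilon><..} x \<partial>\<rho> n) \<le> 4 * measure (\<rho> n) {\<epsilon><..}" for n
      proof -
        interpret real_distribution "\<rho> n" by (rule \<rho>)
        have "(\<integral>x. w s x * indicator {\<epsilon><..} x \<partial>\<rho> n) \<le> (\<integral>x. 4 * indicator {\<epsilon><..} x \<partial>\<rho> n)"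
          by (intro integral_mono int_w integrable_mult_right int_ind) (auto simp: w_le indicator_def)
        then show ?thesis by simp
      qed
      then show "\<forall>\<^sub>F n in sequentially. n * (\<integral>x. w s x * indicator {\<epsilon><..} x \<partial>\<rho> n) \<le> 4 * (n * measure (\<rho> n) {\<epsilon><..})"
        by (simp add: mult_left_mono mult.left_commute)
      show "(\<lambda>n. 4 * (n * measure (\<rho> n) {\<epsilon><..})) \<longlonglongrightarrow> 0"
        using tails that by (intro tendsto_mult_right_zero) auto
    qed (auto intro!: always_eventually integral_nonneg simp: w_nonneg)
    then have AE_eq: "AE x in \<nu>. \<epsilon> < x \<longrightarrow> cos (s * x) = 1" if "0 < \<epsilon>" for s \<epsilon>
      using weighted[of s] that by blast
    \<comment> \<open>Countably many thresholds and frequencies keep the exceptional set null. For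
      \<open>x > 0\<close> some threshold lies below \<open>x\<close>, and some frequency brings
      \<open>x\<close> into the interval from 0 to 1, where the cosine of a positive argument is
      strictly below 1.\<close>
    have "AE x in \<nu>. \<forall>j k. 1 / Suc j < x \<longrightarrow> cos (1 / Suc k * x) = 1"
      by (intro AE_all_countable[THEN iffD2] allI AE_eq) simp
    then have "AE x in \<nu>. \<not> 0 < x"
    proof eventually_elim
      case (elim x)
      show ?case
      proof
        assume x: "0 < x"
        obtain j where j: "inverse (of_nat (Suc j)) < x" using x reals_Archimedean by blast
        obtain k where k: "x < of_nat k" using reals_Archimedean2 by blast
        have "cos (1 / Suc k * x) = 1" using elim j unfolding inverse_eq_divide by blast
        moreover have "1 / Suc k * x \<le> pi"
        proof (rule order_trans)
          show "1 / Suc k * x \<le> 1" using k by (simp add: field_simps)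
        qed (use pi_gt3 in simp)
        then have "cos (1 / Suc k * x) < cos 0"
          using x by (intro cos_monotone_0_pi) auto
        ultimately show False by simp
      qed
    qed
    then show "emeasure \<nu> {0<..} = 0" by (simp add: null_iff)
  next
    assume null: "emeasure \<nu> {0<..} = 0"
    then have "AE x in \<nu>. \<epsilon> < x \<longrightarrow> cos (s * x) = 1" if "0 < \<epsilon>" for s \<epsilon>
      unfolding null_iff using that by (auto elim!: eventually_mono)
    then have weighted_0: "(\<lambda>n. n * (\<integral>x. w s x * indicator {\<epsilon><..} x \<partial>\<rho> n)) \<longlonglongrightarrow> 0" if "0 < \<epsilon>" for s \<epsilon>
      using weighted[of s] that by blast
    show "\<forall>\<epsilon>>0. (\<lambda>n. n * measure (\<rho> n) {\<epsilon><..}) \<longlonglongrightarrow> 0"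
    proof (intro allI impI tendstoI)
      fix \<epsilon> \<eta> :: real assume pos: "0 < \<epsilon>" "0 < \<eta>"
      define V where "V = (\<integral>x. x\<^sup>2 \<partial>\<mu>)"
      have "0 \<le> V" by (simp add: V_def)
      \<comment> \<open>Makes the Chebyshev term \<open>V / L^2\<close> smaller than
        \<open>\<eta> / 2\<close>; the other half of \<eta> is left for the weighted tail.\<close>
      define L where "L = max \<epsilon> (sqrt (2 * V / \<eta>) + 1)"
      have L: "0 < L" "\<epsilon> \<le> L" using pos by (auto simp: L_def)
      have "sqrt (2 * V / \<eta>) < L" by (auto simp: L_def)
      then have "2 * V / \<eta> < L\<^sup>2"
        using L pos \<open>0 \<le> V\<close> by (metis real_less_rsqrt real_sqrt_less_iff real_sqrt_abs abs_of_pos)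
      then have VL: "V / L\<^sup>2 < \<eta> / 2" using L pos by (simp add: field_simps)
      \<comment> \<open>The minimum of the weight on \<open>{\<epsilon>..L}\<close>: there
        \<open>x / L\<close> stays in the range from 0 to 1, where cosine decreases, so the left
        endpoint is the worst.\<close>
      define c where "c = w (1 / L) \<epsilon>"
      have le_pi: "1 / L * x \<le> pi" if "x \<le> L" for x
      proof (rule order_trans)
        show "1 / L * x \<le> 1" using that L by (simp add: field_simps)
      qed (use pi_gt3 in simp)
      have c_less: "cos (1 / L * \<epsilon>) < cos 0"
        using L pos le_pi[of \<epsilon>] by (intro cos_monotone_0_pi) auto
      then have "0 < c" by (simp add: c_def w_def)
      have c_le: "c \<le> w (1 / L) x" if "\<epsilon> < x" "x \<le> L" for x
      proof -
        have "cos (1 / L * x) \<le> cos (1 / L * \<epsilon>)"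
          using L pos that le_pi[of x] by (intro cos_monotone_0_pi_le) (auto simp: divide_right_mono)
        then show ?thesis using c_less unfolding c_def w_def by (intro power_mono) auto
      qed
      have pointwise: "indicator {\<epsilon><..} x \<le> 1 / c * (w (1 / L) x * indicator {\<epsilon><..} x) + 1 / L\<^sup>2 * x\<^sup>2" for x
      proof (cases "\<epsilon> < x")
        case True
        show ?thesis
        proof (cases "x \<le> L")
          case True
          then show ?thesis
            using c_le[OF \<open>\<epsilon> < x\<close>] \<open>0 < c\<close> \<open>\<epsilon> < x\<close> by (simp add: add_increasing2)
        next
          case False
          then have "L\<^sup>2 \<le> x\<^sup>2" using L by (intro power_mono) auto
          then show ?thesis
            using L \<open>\<epsilon> < x\<close> \<open>0 < c\<close> by (simp add: add_increasing w_nonneg)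
        qed
      qed (use w_nonneg \<open>0 < c\<close> in auto)
      have "(\<lambda>n. 1 / c * (n * (\<integral>x. w (1 / L) x * indicator {\<epsilon><..} x \<partial>\<rho> n))) \<longlonglongrightarrow> 0"
        using pos by (intro tendsto_mult_right_zero weighted_0)
      then have "\<forall>\<^sub>F n in sequentially. 1 / c * (n * (\<integral>x. w (1 / L) x * indicator {\<epsilon><..} x \<partial>\<rho> n)) < \<eta> / 2"
        using pos by (intro order_tendstoD) auto
      then show "\<forall>\<^sub>F n in sequentially. dist (n * measure (\<rho> n) {\<epsilon><..}) 0 < \<eta>"
        using eventually_ge_at_top[of 1]
      proof eventually_elim
        case (elim n)
        interpret real_distribution "\<rho> n" by (rule \<rho>)
        note moments = convolution_root_moments[OF root[OF elim(2)] elim(2) int mean]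
        have "measure (\<rho> n) {\<epsilon><..} = (\<integral>x. indicator {\<epsilon><..} x \<partial>\<rho> n)" by simp
        also have "\<dots> \<le> (\<integral>x. 1 / c * (w (1 / L) x * indicator {\<epsilon><..} x) + 1 / L\<^sup>2 * x\<^sup>2 \<partial>\<rho> n)"
          by (intro integral_mono int_ind Bochner_Integration.integrable_add integrable_mult_right int_w moments(1) pointwise)
        also have "\<dots> = 1 / c * (\<integral>x. w (1 / L) x * indicator {\<epsilon><..} x \<partial>\<rho> n) + 1 / L\<^sup>2 * (\<integral>x. x\<^sup>2 \<partial>\<rho> n)"
          by (subst Bochner_Integration.integral_add) (intro integrable_mult_right int_w moments(1), intro integrable_mult_right int_w moments(1), simp)
        finally have "n * measure (\<rho> n) {\<epsilon><..} \<le> n * (1 / c * (\<integral>x. w (1 / L) x * indicator {\<epsilon><..} x \<partial>\<rho> n) + 1 / L\<^sup>2 * (\<integral>x. x\<^sup>2 \<partial>\<rho> n))"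
          by (intro mult_left_mono) auto
        also have "\<dots> = 1 / c * (n * (\<integral>x. w (1 / L) x * indicator {\<epsilon><..} x \<partial>\<rho> n)) + V / L\<^sup>2"
          unfolding V_def moments(4)[symmetric] by (simp add: algebra_simps)
        also have "\<dots> < \<eta>" using elim(1) VL by linarith
        finally show ?case by simp
      qed
    qed
  }
qed
subsection \<open>The constants and the Gaussian case\<close>

text \<open>For a finite exponential moment this is monotonicity of \<open>exp\<close>, using that
  the moment is positive. Otherwise both sides fail: the cumulant is infinite by definition and so
  is the nonnegative integral.\<close>

lemma (in prob_space) cumulant_le_iff:
  assumes [measurable]: "X \<in> borel_measurable M"
  shows "cumulant M X t \<le> ereal y \<longleftrightarrow> (\<integral>\<^sup>+\<omega>. ennreal (exp (t * X \<omega>)) \<partial>M) \<le> ennreal (exp y)"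
proof (cases "integrable M (\<lambda>\<omega>. exp (t * X \<omega>))")
  case True
  have "\<not> (AE \<omega> in M. exp (t * X \<omega>) = 0)" by simp
  then have "(\<integral>\<omega>. exp (t * X \<omega>) \<partial>M) \<noteq> 0"
    using True by (subst integral_nonneg_eq_0_iff_AE) auto
  then have pos: "0 < (\<integral>\<omega>. exp (t * X \<omega>) \<partial>M)"
    by (simp add: order.not_eq_order_implies_strict)
  have "ln (\<integral>\<omega>. exp (t * X \<omega>) \<partial>M) \<le> y \<longleftrightarrow> (\<integral>\<omega>. exp (t * X \<omega>) \<partial>M) \<le> exp y"
    using pos by (metis exp_le_cancel_iff exp_ln)
  then show ?thesis
    using True by (simp add: cumulant_def nn_integral_eq_integral)
next
  case False
  have "(\<integral>\<^sup>+\<omega>. ennreal (exp (t * X \<omega>)) \<partial>M) = \<infinity>"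
  proof (rule ccontr)
    assume "(\<integral>\<^sup>+\<omega>. ennreal (exp (t * X \<omega>)) \<partial>M) \<noteq> \<infinity>"
    then have "integrable M (\<lambda>\<omega>. exp (t * X \<omega>))"
      by (intro integrableI_nonneg) (simp_all add: less_top)
    with False show False ..
  qed
  with False show ?thesis by (simp add: cumulant_def top_unique)
qed

text \<open>An infimum of 0 provides admissible constants below every \<delta> > 0. The bound
  increases with the constant, so it holds with \<delta> itself, and \<delta> may tend to 0 for
  fixed \<open>t\<close>. Conversely the limiting bound says that 0 is admissible.\<close>

lemma (in prob_space) c_plus_eq_0_iff:
  assumes X: "X \<in> borel_measurable M" and V: "V = variance X"
  shows "c_plus M X = 0 \<longleftrightarrow>
    (\<forall>t\<ge>0. (\<integral>\<^sup>+\<omega>. ennreal (exp (t * X \<omega>)) \<partial>M) \<le> ennreal (exp (V * t\<^sup>2 / 2)))"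
proof -
  have "0 \<le> V" unfolding V by simp
  define S where "S = {c::real. 0 \<le> c \<and> (\<forall>t. 0 \<le> t \<longrightarrow> ereal t < 1 / ereal c \<longrightarrow>
      cumulant M X t \<le> ereal (V * t\<^sup>2 / (2 * (1 - c * t))))}"
  have c_plus: "c_plus M X = Inf (ereal ` S)"
    unfolding c_plus_def S_def V by (rule arg_cong[where f=Inf]) auto
  have "c_plus M X = 0 \<longleftrightarrow> (\<forall>t\<ge>0. cumulant M X t \<le> ereal (V * t\<^sup>2 / 2))"
  proof (intro iffI allI impI)
    fix t :: real assume zero: "c_plus M X = 0" and t: "0 \<le> t"
    show "cumulant M X t \<le> ereal (V * t\<^sup>2 / 2)"
    proof (rule tendsto_lowerbound)
      have "((\<lambda>\<delta>. V * t\<^sup>2 / (2 * (1 - \<delta> * t))) \<longlongrightarrow> V * t\<^sup>2 / (2 * (1 - 0 * t))) (at_right 0)"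
        by (intro tendsto_intros) auto
      then show "((\<lambda>\<delta>. ereal (V * t\<^sup>2 / (2 * (1 - \<delta> * t)))) \<longlongrightarrow> ereal (V * t\<^sup>2 / 2)) (at_right 0)"
        by simp
      \<comment> \<open>This threshold ensures \<open>\<delta> * t < 1\<close>, also for
        \<open>t = 0\<close>, so the denominators stay positive.\<close>
      have "\<forall>\<^sub>F \<delta> in at_right (0::real). \<delta> < 1 / (t + 1)"
        using t by (intro order_tendstoD(2)[OF tendsto_ident_at]) auto
      then show "\<forall>\<^sub>F \<delta> in at_right 0. cumulant M X t \<le> ereal (V * t\<^sup>2 / (2 * (1 - \<delta> * t)))"
        using eventually_at_right_less[of "0::real"]
      proof eventually_elim
        case (elim \<delta>)
        have "\<delta> * t + \<delta> < 1" using elim t by (simp add: field_simps)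
        then have \<delta>: "\<delta> * t < 1" using elim by simp
        have "Inf (ereal ` S) < ereal \<delta>" using zero elim by (simp add: c_plus)
        then obtain c where c: "c \<in> S" "c < \<delta>" by (auto simp: Inf_less_iff)
        then have "0 \<le> c" by (simp add: S_def)
        have "c * t \<le> \<delta> * t" using c t by (intro mult_right_mono) auto
        have "ereal t < 1 / ereal c"
        \<comment> \<open>For \<open>c = 0\<close> the quotient is infinite in \<open>ereal\<close>,
          so every \<open>t\<close> is allowed.\<close>
        proof (cases "c = 0")
          case True
          then show ?thesis by (simp add: divide_ereal_def flip: zero_ereal_def)
        next
          case False
          then show ?thesis
            using \<open>c * t \<le> \<delta> * t\<close> \<delta> \<open>0 \<le> c\<close> by (simp add: one_ereal_def field_simps)
        qed
        then have "cumulant M X t \<le> ereal (V * t\<^sup>2 / (2 * (1 - c * t)))"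
          using c t by (simp add: S_def)
        also have "\<dots> \<le> ereal (V * t\<^sup>2 / (2 * (1 - \<delta> * t)))"
          using \<open>c * t \<le> \<delta> * t\<close> \<delta> \<open>0 \<le> V\<close> by (auto intro!: divide_left_mono mult_pos_pos)
        finally show ?case .
      qed
    qed simp
  next
    assume "\<forall>t\<ge>0. cumulant M X t \<le> ereal (V * t\<^sup>2 / 2)"
    then have "0 \<in> S" by (simp add: S_def)
    then have "c_plus M X \<le> 0"
      unfolding c_plus by (intro Inf_lower2[of "ereal 0"]) auto
    moreover have "0 \<le> c_plus M X"
      unfolding c_plus by (rule Inf_greatest) (auto simp: S_def)
    ultimately show "c_plus M X = 0" by (rule antisym)
  qed
  then show ?thesis by (simp add: cumulant_le_iff[OF X])
qed

text \<open>The truncation interval is symmetric, so reflection needs no drift correction: the law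
  at frequency \<open>u\<close> is evaluated at \<open>- u\<close>, which negates the drift and
  keeps the Gaussian variance.\<close>

lemma levy_triplet_reflect:
  assumes triplet: "levy_triplet \<mu> b a \<nu>" and \<mu>: "sets \<mu> = sets borel"
  shows "levy_triplet (distr \<mu> borel uminus) (- b) a (distr \<nu> borel uminus)"
proof -
  have \<nu>: "sets \<nu> = sets borel" "emeasure \<nu> {0} = 0" "(\<integral>\<^sup>+ x. ennreal (min 1 (x\<^sup>2)) \<partial>\<nu>) < \<infinity>"
    and a: "0 \<le> a" and char: "\<And>u. char \<mu> u =
        exp (\<i> * complex_of_real (b * u) - complex_of_real (a * u\<^sup>2 / 2)
             + (CLINT x|\<nu>. iexp (u * x) - 1 - \<i> * complex_of_real (u * x * indicator {-1..1} x)))"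
    using triplet by (auto simp: levy_triplet_def levy_measure_def)
  note [measurable_cong] = \<mu> \<nu>(1)
  have space: "space \<nu> = UNIV" using sets_eq_imp_space_eq[OF \<nu>(1)] by simp
  have "levy_measure (distr \<nu> borel uminus)"
    unfolding levy_measure_def
  proof (intro conjI)
    have "uminus -` {0} \<inter> space \<nu> = {0 :: real}" by (auto simp: space)
    then show "emeasure (distr \<nu> borel uminus) {0} = 0"
      using \<nu>(2) by (subst emeasure_distr) auto
    show "(\<integral>\<^sup>+ x. ennreal (min 1 (x\<^sup>2)) \<partial>distr \<nu> borel uminus) < \<infinity>"
      using \<nu>(3) by (subst nn_integral_distr) auto
  qed simp
  moreover have "char (distr \<mu> borel uminus) u =
        exp (\<i> * complex_of_real (- b * u) - complex_of_real (a * u\<^sup>2 / 2)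
             + (CLINT x|distr \<nu> borel uminus. iexp (u * x) - 1
                  - \<i> * complex_of_real (u * x * indicator {-1..1} x)))" for u
  proof -
    have "char (distr \<mu> borel uminus) u = char \<mu> (- u)"
      unfolding char_def by (subst integral_distr) auto
    moreover have "(CLINT x|distr \<nu> borel uminus. iexp (u * x) - 1
                  - \<i> * complex_of_real (u * x * indicator {-1..1} x))
      = (CLINT x|\<nu>. iexp (- u * x) - 1 - \<i> * complex_of_real (- u * x * indicator {-1..1} x))"
    proof (subst integral_distr)
      have "indicator {-1..1} (- x) = (indicator {-1..1} x :: real)" for x :: real
        by (auto simp: indicator_def)
      then show "(CLINT x|\<nu>. iexp (u * - x) - 1 - \<i> * complex_of_real (u * - x * indicator {-1..1} (- x)))
          = (CLINT x|\<nu>. iexp (- u * x) - 1 - \<i> * complex_of_real (- u * x * indicator {-1..1} x))"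
        by simp
    qed measurable
    ultimately show ?thesis by (simp add: char)
  qed
  ultimately show ?thesis using a by (simp add: levy_triplet_def)
qed

section \<open>The normal law\<close>

text \<open>Completing the square: tilting the centered normal density by \<open>exp (t * x)\<close>
  shifts its mean to \<open>\<sigma>^2 * t\<close>, up to the stated constant.\<close>

lemma nn_integral_exp_normal_density:
  assumes \<sigma>: "0 < \<sigma>"
  shows "(\<integral>\<^sup>+x. ennreal (normal_density 0 \<sigma> x) * ennreal (exp (t * x)) \<partial>lborel)
    = ennreal (exp (\<sigma>\<^sup>2 * t\<^sup>2 / 2))"
proof -
  have "normal_density 0 \<sigma> x * exp (t * x) = exp (\<sigma>\<^sup>2 * t\<^sup>2 / 2) * normal_density (\<sigma>\<^sup>2 * t) \<sigma> x" for x
  proof -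
    have "- (x - 0)\<^sup>2 / (2 * \<sigma>\<^sup>2) + t * x = \<sigma>\<^sup>2 * t\<^sup>2 / 2 + - (x - \<sigma>\<^sup>2 * t)\<^sup>2 / (2 * \<sigma>\<^sup>2)"
      using \<sigma> by (simp add: field_simps power2_eq_square)
    then show ?thesis
      unfolding normal_density_def by (simp add: mult.left_commute flip: exp_add)
  qed
  then have "(\<integral>\<^sup>+x. ennreal (normal_density 0 \<sigma> x) * ennreal (exp (t * x)) \<partial>lborel)
      = (\<integral>\<^sup>+x. ennreal (exp (\<sigma>\<^sup>2 * t\<^sup>2 / 2)) * ennreal (normal_density (\<sigma>\<^sup>2 * t) \<sigma> x) \<partial>lborel)"
    by (simp flip: ennreal_mult')
  also have "\<dots> = ennreal (exp (\<sigma>\<^sup>2 * t\<^sup>2 / 2)) * (\<integral>\<^sup>+x. ennreal (normal_density (\<sigma>\<^sup>2 * t) \<sigma> x) \<partial>lborel)"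
    by (rule nn_integral_cmult) simp
  also have "(\<integral>\<^sup>+x. ennreal (normal_density (\<sigma>\<^sup>2 * t) \<sigma> x) \<partial>lborel) = 1"
    using \<sigma> by (subst nn_integral_eq_integral) auto
  finally show ?thesis by simp
qed

lemma (in prob_space) distributed_normal_exp:
  assumes "distributed M lborel X (normal_density 0 \<sigma>)" "0 < \<sigma>"
  shows "(\<integral>\<^sup>+\<omega>. ennreal (exp (t * X \<omega>)) \<partial>M) = ennreal (exp (\<sigma>\<^sup>2 * t\<^sup>2 / 2))"
  using distributed_nn_integral[OF assms(1), of "\<lambda>x. ennreal (exp (t * x))"]
  by (simp add: nn_integral_exp_normal_density[OF assms(2)])

text \<open>Without jumps the characteristic function is that of \<open>b + sqrt a * Z\<close> with
  \<open>Z\<close> standard normal. Levy's uniqueness theorem identifies the laws, and comparing the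
  first two moments gives \<open>b = 0\<close> and \<open>a\<close> equal to the variance.\<close>

lemma levy_triplet_null_imp_normal:
  assumes "real_distribution \<mu>" and triplet: "levy_triplet \<mu> b a \<nu>" and null: "emeasure \<nu> UNIV = 0"
    and mean: "(\<integral>x. x \<partial>\<mu>) = 0" and pos: "0 < (\<integral>x. x\<^sup>2 \<partial>\<mu>)"
  shows "\<mu> = density lborel (normal_density 0 (sqrt (\<integral>x. x\<^sup>2 \<partial>\<mu>)))"
proof -
  have "sets \<nu> = sets borel" and a: "0 \<le> a" using triplet by (auto simp: levy_triplet_def levy_measure_def)
  then have "space \<nu> = UNIV" using sets_eq_imp_space_eq[of \<nu> borel] by simp
  then have "AE x in \<nu>. False" using null by (intro AE_I[of _ _ UNIV]) (auto simp: \<open>sets \<nu> = sets borel\<close>)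
  then have "(CLINT x|\<nu>. f x) = 0" for f by (intro integral_eq_zero_AE) auto
  then have char: "char \<mu> u = exp (\<i> * complex_of_real (b * u) - complex_of_real (a * u\<^sup>2 / 2))" for u
    using triplet by (simp add: levy_triplet_def)
  interpret Z: real_distribution std_normal_distribution by (rule real_dist_normal_dist)
  have int_Z: "integrable std_normal_distribution (\<lambda>x. x)" "(\<integral>x. x \<partial>std_normal_distribution) = 0"
      "integrable std_normal_distribution (\<lambda>x. x\<^sup>2)" "(\<integral>x. x\<^sup>2 \<partial>std_normal_distribution) = 1"
    using integrable_std_normal_distribution_moment[of 1] integral_std_normal_distribution_moment_odd[of 1]
      std_normal_distribution_even_moments[of 1]
    by (auto simp: numeral_2_eq_2)
  have sqrt_a: "(complex_of_real (sqrt a))\<^sup>2 = of_real a"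
    using a by (simp flip: of_real_power)
  \<comment> \<open>An image of the standard normal law, rather than a normal density, makes sense
    also for \<open>a = 0\<close>, which is excluded only once \<open>a\<close> is known to be the
    variance.\<close>
  define \<gamma> where "\<gamma> = distr std_normal_distribution borel (\<lambda>z. b + sqrt a * z)"
  have "char \<gamma> u = char \<mu> u" for u
  proof -
    have "char \<gamma> u = (CLINT z|std_normal_distribution. iexp (u * b) * iexp ((u * sqrt a) * z))"
      unfolding char_def \<gamma>_def
      by (subst integral_distr) (simp_all add: algebra_simps flip: exp_add)
    also have "\<dots> = iexp (u * b) * char std_normal_distribution (u * sqrt a)"
      by (simp add: char_def)
    also have "\<dots> = char \<mu> u"
      using sqrt_a
      by (simp add: char char_std_normal_distribution power_mult_distrib mult.commute flip: exp_of_real exp_add)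
    finally show ?thesis .
  qed
  then have "char \<mu> = char \<gamma>" by (simp add: fun_eq_iff)
  moreover have "real_distribution \<gamma>"
    unfolding \<gamma>_def by (rule Z.real_distribution_distr) simp
  ultimately have \<mu>: "\<mu> = \<gamma>"
    using assms(1) by (intro Levy_uniqueness)
  have mass: "measure std_normal_distribution UNIV = 1"
    using Z.prob_space by simp
  have "(\<integral>x. x \<partial>\<gamma>) = (\<integral>z. b + sqrt a * z \<partial>std_normal_distribution)"
    unfolding \<gamma>_def by (rule integral_distr) auto
  also have "\<dots> = b + sqrt a * (\<integral>z. z \<partial>std_normal_distribution)"
    using int_Z(1) mass by (subst Bochner_Integration.integral_add) auto
  finally have "b = 0" using mean int_Z(2) by (simp add: \<mu>)
  have "(\<integral>x. x\<^sup>2 \<partial>\<gamma>) = (\<integral>z. (b + sqrt a * z)\<^sup>2 \<partial>std_normal_distribution)"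
    unfolding \<gamma>_def by (rule integral_distr) auto
  also have "\<dots> = (\<integral>z. a * z\<^sup>2 \<partial>std_normal_distribution)"
    using a \<open>b = 0\<close> by (simp add: power_mult_distrib)
  also have "\<dots> = a" by (simp only: integral_mult_right_zero int_Z(4) mult_1_right)
  finally have "(\<integral>x. x\<^sup>2 \<partial>\<mu>) = a" by (simp add: \<mu>)
  have a_pos: "0 < a" using pos unfolding \<open>(\<integral>x. x\<^sup>2 \<partial>\<mu>) = a\<close> .
  have "distributed std_normal_distribution lborel (\<lambda>x. x) std_normal_density"
    unfolding distributed_def by (intro conjI distr_id2) simp_all
  from Z.normal_density_affine[OF this zero_less_one, of "sqrt a" b]
  have normal: "distr std_normal_distribution lborel (\<lambda>z. b + sqrt a * z) = density lborel (normal_density 0 (sqrt a))"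
    using a_pos \<open>b = 0\<close> by (intro distributed_distr_eq_density) simp
  have "distr std_normal_distribution lborel (\<lambda>z. b + sqrt a * z) = \<gamma>"
    unfolding \<gamma>_def by (rule distr_cong) auto
  from trans[OF sym[OF this] normal] show ?thesis
    unfolding \<open>(\<integral>x. x\<^sup>2 \<partial>\<mu>) = a\<close> unfolding \<mu> .
qed

section \<open>Assembly of the equivalences\<close>

lemma c_plus_eq_0_iff_levy_measure:
  fixes M :: "'a measure" and X :: "'a \<Rightarrow> real"
  assumes "prob_space M" and X: "X \<in> borel_measurable M"
    and div: "infinitely_divisible (distr M borel X)"
    and triplet: "levy_triplet (distr M borel X) b a \<nu>"
    and int: "integrable M (\<lambda>\<omega>. (X \<omega>)\<^sup>2)"
    and mean: "prob_space.expectation M X = 0"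
  shows "c_plus M X = 0 \<longleftrightarrow> emeasure \<nu> {0<..} = 0"
proof -
  interpret prob_space M by fact
  note [measurable] = X
  define \<mu> where "\<mu> = distr M borel X"
  \<comment> \<open>At index 0 the standard normal law is a placeholder, so that every member of the
    sequence is a probability law on the reals.\<close>
  have "\<forall>n. \<exists>\<rho>. real_distribution \<rho> \<and> (n \<ge> 1 \<longrightarrow> convolution_root n \<mu> \<rho>)"
  proof
    fix n :: nat
    show "\<exists>\<rho>. real_distribution \<rho> \<and> (n \<ge> 1 \<longrightarrow> convolution_root n \<mu> \<rho>)"
      using div real_dist_normal_dist unfolding infinitely_divisible_def convolution_root_def \<mu>_def
      by (cases "n \<ge> 1") blast+
  qed
  then obtain \<rho> where \<rho>: "\<And>n. real_distribution (\<rho> n)"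
    and root: "\<And>n. n \<ge> 1 \<Longrightarrow> convolution_root n \<mu> (\<rho> n)"
    by metis
  have \<mu>_dist: "real_distribution \<mu>" unfolding \<mu>_def by (rule real_distribution_distr) simp
  have \<mu>_int: "integrable \<mu> (\<lambda>x. x\<^sup>2)"
    using int unfolding \<mu>_def by (subst integrable_distr_eq) auto
  have \<mu>_mean: "(\<integral>x. x \<partial>\<mu>) = 0"
    using mean unfolding \<mu>_def by (subst integral_distr) auto
  have \<mu>_var: "(\<integral>x. x\<^sup>2 \<partial>\<mu>) = variance X"
    unfolding \<mu>_def by (subst integral_distr) (auto simp: mean)
  have "c_plus M X = 0 \<longleftrightarrow>
      (\<forall>t\<ge>0. (\<integral>\<^sup>+x. ennreal (exp (t * x)) \<partial>\<mu>) \<le> ennreal (exp (variance X * t\<^sup>2 / 2)))"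
    unfolding c_plus_eq_0_iff[OF X refl] \<mu>_def by (subst nn_integral_distr) auto
  also have "\<dots> \<longleftrightarrow> (\<forall>\<epsilon>>0. (\<lambda>n. n * measure (\<rho> n) {\<epsilon><..}) \<longlonglongrightarrow> 0)"
    by (intro subgaussian_iff_tails_vanish root \<mu>_dist \<mu>_int \<mu>_mean \<mu>_var)
  also have "\<dots> \<longleftrightarrow> emeasure \<nu> {0<..} = 0"
    by (intro tails_vanish_iff_levy_measure[of \<rho> \<mu> b a] \<rho> root triplet[folded \<mu>_def] \<mu>_int \<mu>_mean)
  finally show ?thesis .
qed

theorem theorem3p2:
  fixes M :: "'a measure" and X :: "'a \<Rightarrow> real" and \<nu> :: "real measure" and a b V :: real
  assumes "prob_space M"
    and "X \<in> borel_measurable M"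
    and "infinitely_divisible (distr M borel X)"
    and "levy_triplet (distr M borel X) b a \<nu>"
    and "integrable M (\<lambda>\<omega>. (X \<omega>)\<^sup>2)"
    and "prob_space.expectation M X = 0"
    and "V = prob_space.variance M X"
    and "V > 0"
  shows "(c_plus M X = 0 \<longleftrightarrow> emeasure \<nu> {0<..} = 0)
       \<and> (c_minus M X = 0 \<longleftrightarrow> emeasure \<nu> {..<0} = 0)
       \<and> (c_plus M X = 0 \<and> c_minus M X = 0 \<longleftrightarrow>
            distributed M lborel X (normal_density 0 (sqrt V)))"
proof -
  interpret prob_space M by fact
  note X [measurable] = assms(2)
  define \<mu> where "\<mu> = distr M borel X"
  have sets_\<nu>: "sets \<nu> = sets borel" and null_0: "emeasure \<nu> {0} = 0"
    using assms(4) unfolding levy_triplet_def levy_measure_def by blast+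
  have space_\<nu>: "space \<nu> = UNIV" using sets_eq_imp_space_eq[OF sets_\<nu>] by simp
  note [measurable_cong] = sets_\<nu>

  have plus: "c_plus M X = 0 \<longleftrightarrow> emeasure \<nu> {0<..} = 0"
    using assms by (intro c_plus_eq_0_iff_levy_measure)

  have distr_minus: "distr M borel (\<lambda>\<omega>. - X \<omega>) = distr (distr M borel X) borel uminus"
    by (subst distr_distr) (auto simp: comp_def)
  have "c_plus M (\<lambda>\<omega>. - X \<omega>) = 0 \<longleftrightarrow> emeasure (distr \<nu> borel uminus) {0<..} = 0"
  proof (rule c_plus_eq_0_iff_levy_measure[OF assms(1)])
    show "infinitely_divisible (distr M borel (\<lambda>\<omega>. - X \<omega>))"
      unfolding distr_minus using assms(3) by (rule infinitely_divisible_reflect)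
    show "levy_triplet (distr M borel (\<lambda>\<omega>. - X \<omega>)) (- b) a (distr \<nu> borel uminus)"
      unfolding distr_minus using assms(4) by (rule levy_triplet_reflect) simp
  qed (use assms in auto)
  also have "emeasure (distr \<nu> borel uminus) {0<..} = emeasure \<nu> (uminus -` {0<..} \<inter> space \<nu>)"
    by (rule emeasure_distr) (simp_all add: measurable_cong_sets[OF sets_\<nu> refl])
  also have "uminus -` {0<..} \<inter> space \<nu> = {..<0 :: real}" by (auto simp: space_\<nu>)
  finally have minus: "c_minus M X = 0 \<longleftrightarrow> emeasure \<nu> {..<0} = 0"
    unfolding c_minus_def .

  have "c_plus M X = 0 \<and> c_minus M X = 0 \<longleftrightarrow> distributed M lborel X (normal_density 0 (sqrt V))"
  proof
    assume "c_plus M X = 0 \<and> c_minus M X = 0"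
    \<comment> \<open>The two half-lines are null by the equivalences already shown, and
      \<open>{0}\<close> is null by the convention for Levy measures.\<close>
    then have "{..<0} \<union> {0} \<union> {0<..} \<in> null_sets \<nu>"
      using plus minus null_0 by (intro null_sets.Un null_setsI) (simp_all add: sets_\<nu>)
    moreover have "{..<0} \<union> {0} \<union> {0<..} = (UNIV :: real set)" by auto
    ultimately have null: "emeasure \<nu> UNIV = 0" by (metis null_setsD1)
    have var: "(\<integral>x. x\<^sup>2 \<partial>\<mu>) = V"
      unfolding \<mu>_def assms(7) by (subst integral_distr) (auto simp: assms(6))
    have "(\<integral>x. x \<partial>\<mu>) = 0"
      using assms(6) unfolding \<mu>_def by (subst integral_distr) auto
    then have "\<mu> = density lborel (normal_density 0 (sqrt V))"
      using levy_triplet_null_imp_normal[OF _ assms(4)[folded \<mu>_def] null] assms(8)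
      unfolding var by (simp add: \<mu>_def)
    moreover have "distr M lborel X = \<mu>"
      unfolding \<mu>_def by (rule distr_cong) auto
    ultimately show "distributed M lborel X (normal_density 0 (sqrt V))"
      by (simp add: distributed_def)
  next
    assume normal: "distributed M lborel X (normal_density 0 (sqrt V))"
    \<comment> \<open>A normal law attains the required exponential bound with equality for every
      real \<open>t\<close>. Using \<open>t\<close> and \<open>- t\<close> settles both constants
      without passing through the Levy measure.\<close>
    have "(\<integral>\<^sup>+\<omega>. ennreal (exp (t * X \<omega>)) \<partial>M) = ennreal (exp (V * t\<^sup>2 / 2))" for t
      using distributed_normal_exp[OF normal, of t] assms(8) by simp
    from this this[of "- _"] show "c_plus M X = 0 \<and> c_minus M X = 0"
      using c_plus_eq_0_iff[OF X assms(7)] c_plus_eq_0_iff[of "\<lambda>\<omega>. - X \<omega>" V] assms(6,7)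
      by (simp add: c_minus_def)
  qed
  with plus minus show ?thesis by blast
qed

end
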